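(* Let $(Z_i)_{i\ge1}$ be i.i.d. standard normal random variables, let $\lambda_1,\dots,\lambda_q$ be distinct non-zero real numbers, and let $A_n=(a_{i,j}(n))$ be real symmetric $n\times n$ matrices. Assume that there are real numbers $b_i^m(n)$ ($1\le i\le n$, $1\le m\le q$) such that $$\sum_{i=1}^n b_i^m(n)b_i^k(n)\to\delta_{km}\ \ (1\le k,m\le q),\qquad \exists b>0\ \forall i,m,n:\ \sqrt n\,|b_i^m(n)|\le b,$$ $$\sum_{i,j=1}^n a_{i,j}(n)b_i^m(n)b_j^m(n)\to\lambda_m\ \ (1\le m\le q),\qquad \sum_{i,j=1}^n a_{i,j}(n)^2\to\sum_{m=1}^q\lambda_m^2 .$$ Set $\tilde a_{i,j}(n)=a_{i,j}(n)\big(\sum_{i,j}a_{i,j}(n)^2\big)^{-1/2}$, $\tilde A_n=(\tilde a_{i,j}(n))$, $\tilde\lambda_m=\lambda_m\big(\sum_{l=1}^q\lambda_l^2\big)^{-1/2}$, $$\tilde Q_n(Z)=\sum_{i,j=1}^n\tilde a_{i,j}(n)Z_iZ_j,\qquad \tilde Q_\infty=\sum_{m=1}^q\tilde\lambda_m(Z_m^2-1).$$ Then there is a constant $C>0$, depending only on $\tilde Q_\infty$, such that $$\mathbf{W}_2\big(\tilde Q_n(Z)-\mathbb{E}[\tilde Q_n(Z)],\tilde Q_\infty\big)\le C\left(\sqrt{\sum_{r=2}^{2q+2}\Theta_r\Big[\operatorname{Tr}(\tilde A_n^r)-\sum_{m=1}^q\tilde\lambda_m^r\Big]}+\sum_{r=2}^{q+1}2^{r-1}(r-1)!\,\Big|\operatorname{Tr}(\tilde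 A_n^r)-\sum_{m=1}^q\tilde\lambda_m^r\Big|\right).$$
   Context: $\mathbf{W}_2(F,G)=(\inf \mathbb{E}|X-Y|^2)^{1/2}$, the infimum being over all couplings $(X,Y)$ with $X\sim F$, $Y\sim G$ in law. The $\Theta_r$, $2\le r\le 2q+2$, are the coefficients of the polynomial $$\Big(x\prod_{m=1}^q(x-\tilde\lambda_m)\Big)^2=\sum_{r=2}^{2q+2}\Theta_r x^r .$$ The normalized matrix $\tilde A_n$ is defined for those $n$ with $\sum_{i,j}a_{i,j}(n)^2\neq0$ (all sufficiently large $n$), and the bound is for those $n$. *)

theory Defs
  imports "HOL-Probability.Probability" "Jordan_Normal_Form.Matrix"
begin

text \<open>All indices of random variables, coefficients and matrix entries start at \<open>0\<close>.\<close>

definition iid_std_normal :: "'a measure \<Rightarrow> (nat \<Rightarrow> 'a \<Rightarrow> real) \<Rightarrow> bool" where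
  "iid_std_normal M Z \<longleftrightarrow> prob_space M \<and> prob_space.indep_vars M (\<lambda>_. borel) Z UNIV \<and>
     (\<forall>i. distributed M lborel (Z i) std_normal_density)"

definition couplings :: "real measure \<Rightarrow> real measure \<Rightarrow> (real \<times> real) measure set" where
  "couplings F G = {P. prob_space P \<and> sets P = sets (borel \<Otimes>\<^sub>M borel) \<and>
     distr P borel fst = F \<and> distr P borel snd = G}"

text \<open>The infimum is taken in the extended nonnegative reals, so that a non-integrable cost counts
  as \<open>\<infinity>\<close> (the Bochner integral would give \<open>0\<close>).\<close>

definition ennreal_sqrt :: "ennreal \<Rightarrow> ennreal" where
  "ennreal_sqrt x = (if x = \<infinity> then \<infinity> else ennreal (sqrt (enn2real x)))"

definition W2 :: "real measure \<Rightarrow> real measure \<Rightarrow> ennreal" where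
  "W2 F G = ennreal_sqrt (INF P \<in> couplings F G. \<integral>\<^sup>+ (x, y). ennreal (\<bar>x - y\<bar>\<^sup>2) \<partial>P)"

definition mat_trace :: "'a::comm_monoid_add mat \<Rightarrow> 'a" where
  "mat_trace A = (\<Sum>i<dim_row A. A $$ (i, i))"

definition sum_squares :: "real mat \<Rightarrow> real" where
  "sum_squares A = (\<Sum>i<dim_row A. \<Sum>j<dim_col A. (A $$ (i, j))\<^sup>2)"

definition normalized_mat :: "real mat \<Rightarrow> real mat" where
  "normalized_mat A = (1 / sqrt (sum_squares A)) \<cdot>\<^sub>m A"

definition quad_form :: "real mat \<Rightarrow> (nat \<Rightarrow> 'a \<Rightarrow> real) \<Rightarrow> 'a \<Rightarrow> real" where
  "quad_form A Z \<omega> = (\<Sum>i<dim_row A. \<Sum>j<dim_col A. A $$ (i, j) * Z i \<omega> * Z j \<omega>)"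

definition normalized_coeff :: "nat \<Rightarrow> (nat \<Rightarrow> real) \<Rightarrow> nat \<Rightarrow> real" where
  "normalized_coeff q l m = l m / sqrt (\<Sum>k<q. (l k)\<^sup>2)"

definition chi_square_comb :: "nat \<Rightarrow> (nat \<Rightarrow> real) \<Rightarrow> (nat \<Rightarrow> 'a \<Rightarrow> real) \<Rightarrow> 'a \<Rightarrow> real" where
  "chi_square_comb q l Z \<omega> = (\<Sum>m<q. l m * ((Z m \<omega>)\<^sup>2 - 1))"

definition Theta :: "nat \<Rightarrow> (nat \<Rightarrow> real) \<Rightarrow> nat \<Rightarrow> real" where
  "Theta q l r = coeff (([:0, 1:] * (\<Prod>m<q. [:- l m, 1:]))\<^sup>2) r"

end

theory Submission
  imports Defs "Jordan_Normal_Form.Char_Poly"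
    "HOL-Computational_Algebra.Fundamental_Theorem_Algebra"
begin

text \<open>
  Diagonalise the normalized matrix: with eigenvalues \<open>\<mu>\<^sub>1, \<dots>, \<mu>\<^sub>n\<close>, whose squares sum to \<open>1\<close>, the centred
  quadratic form has the law of \<open>\<Sum>k. \<mu>\<^sub>k (W\<^sub>k\<^sup>2 - 1)\<close> with independent standard normal \<open>W\<^sub>k\<close>
  (\<open>spectral_gauss_orth\<close>, \<open>law_centred_quad_form\<close>), and \<open>Tr (A\<^sup>r) = \<Sum>k. \<mu>\<^sub>k\<^sup>r\<close>. So two centred chi-square
  sums have to be compared, and the claim becomes one about their coefficients alone. If each
  limiting coefficient \<open>\<lambda>\<^sub>m\<close> can be paired with an eigenvalue of its own, then using the same normal
  variable for both members of a pair is a coupling whose cost is twice the squared distance of the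
  coefficient vectors, unpaired eigenvalues being compared with \<open>0\<close> (\<open>W2_chi_matched\<close>).

  The combination of traces under the square root is \<open>\<Sum>k. P (\<mu>\<^sub>k)\<^sup>2\<close>, where \<open>P\<close> is the polynomial with
  simple zeros at \<open>0\<close> and the \<open>\<lambda>\<^sub>m\<close>. When it is small, every eigenvalue is close to a zero of \<open>P\<close>, and it
  bounds the squared distance of the eigenvalues to these zeros. That exactly one eigenvalue is near
  each \<open>\<lambda>\<^sub>m\<close> is the role of the remaining terms: the number of eigenvalues near \<open>\<lambda>\<^sub>m\<close> is almost the sum of
  a Lagrange polynomial over the spectrum, hence almost a linear combination of the gaps of order
  \<open>2, \<dots>, q + 1\<close> plus \<open>1\<close>, and it is an integer (\<open>matching_constant_exists\<close>). When the right-hand side is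
  not small, independent copies are good enough, because both laws have variance \<open>2\<close>
  (\<open>W2_chi_trivial\<close>).

  The constant found in this way depends on the set of the \<open>\<lambda>\<^sub>m\<close>. It is a function of the limiting law
  because that law, through its exponential moments, determines the set (\<open>chi_mgf_on_unique\<close>).
\<close>

section \<open>Matching a unit spectrum with the limiting spectrum\<close>

definition gap :: "nat \<Rightarrow> (nat \<Rightarrow> real) \<Rightarrow> real set \<Rightarrow> nat \<Rightarrow> real" where
  "gap n \<mu> \<Lambda> r = (\<Sum>i<n. \<mu> i ^ r) - (\<Sum>x\<in>\<Lambda>. x ^ r)"

text \<open>
  Its square is the polynomial whose coefficients are the weights \<open>\<Theta>\<^sub>r\<close>.
\<close>

definition root_poly :: "real set \<Rightarrow> real poly" where
  "root_poly \<Lambda> = [:0, 1:] * (\<Prod>x\<in>\<Lambda>. [:- x, 1:])"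

definition defect :: "real set \<Rightarrow> (nat \<Rightarrow> real) \<Rightarrow> real" where
  "defect \<Lambda> g = (\<Sum>r = 2..2 * card \<Lambda> + 2. coeff ((root_poly \<Lambda>)\<^sup>2) r * g r)"

definition rate :: "real set \<Rightarrow> (nat \<Rightarrow> real) \<Rightarrow> real" where
  "rate \<Lambda> g = sqrt (defect \<Lambda> g) + (\<Sum>r = 2..card \<Lambda> + 1. 2 ^ (r - 1) * fact (r - 1) * \<bar>g r\<bar>)"

text \<open>
  Power sums of order \<open>r \<ge> 2\<close> see exactly the polynomials with a double zero at the origin. The two
  polynomials used below, \<open>(root_poly \<Lambda>)\<^sup>2\<close> and the one of \<open>selecting_poly\<close>, are both of this kind.
\<close>

lemma sum_coeff_gap:
  assumes "degree p \<le> N" "coeff p 0 = 0" "coeff p 1 = 0"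
  shows "(\<Sum>r = 2..N. coeff p r * gap n \<mu> \<Lambda> r) = (\<Sum>i<n. poly p (\<mu> i)) - (\<Sum>x\<in>\<Lambda>. poly p x)"
proof -
  have *: "poly p x = (\<Sum>r = 2..N. coeff p r * x ^ r)" for x
  proof -
    have "coeff p r = 0" if "r \<notin> {2..N}" "r \<le> degree p" for r
    proof -
      from that assms(1) have "r = 0 \<or> r = 1" by auto
      then show ?thesis using assms by auto
    qed
    then show ?thesis unfolding poly_altdef
      by (intro sum.mono_neutral_cong) (auto simp: coeff_eq_0)
  qed
  show ?thesis
    unfolding * gap_def right_diff_distrib sum_subtractf sum_distrib_left
    by (subst (1 2) sum.swap) (rule refl)
qed

lemma root_poly_props:
  assumes "finite \<Lambda>"
  shows "poly (root_poly \<Lambda>) x = x * (\<Prod>y\<in>\<Lambda>. x - y)"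
    and "degree ((root_poly \<Lambda>)\<^sup>2) \<le> 2 * card \<Lambda> + 2"
    and "coeff ((root_poly \<Lambda>)\<^sup>2) 0 = 0" and "coeff ((root_poly \<Lambda>)\<^sup>2) 1 = 0"
proof -
  show "poly (root_poly \<Lambda>) x = x * (\<Prod>y\<in>\<Lambda>. x - y)"
    by (simp add: root_poly_def poly_prod)
  have "degree (\<Prod>x\<in>\<Lambda>. [:- x, 1:]) \<le> sum (degree \<circ> (\<lambda>x::real. [:- x, 1:])) \<Lambda>"
    using assms by (rule degree_prod_sum_le)
  then have d: "degree (\<Prod>x\<in>\<Lambda>. [:- x, 1:]) \<le> card \<Lambda>" by simp
  have "degree (root_poly \<Lambda>) \<le> card \<Lambda> + 1"
    unfolding root_poly_def
    using degree_mult_le[of "[:0, 1:]" "(\<Prod>x\<in>\<Lambda>. [:- x, 1:])"] d by simp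
  then show "degree ((root_poly \<Lambda>)\<^sup>2) \<le> 2 * card \<Lambda> + 2"
    using degree_mult_le[of "root_poly \<Lambda>" "root_poly \<Lambda>"] by (simp add: power2_eq_square)
  have e: "(root_poly \<Lambda>)\<^sup>2 = Polynomial.monom 1 2 * (\<Prod>x\<in>\<Lambda>. [:- x, 1:])\<^sup>2"
  proof -
    have "Polynomial.monom 1 2 = [:0, 1 :: real:]\<^sup>2" by (simp add: monom_altdef)
    then show ?thesis by (simp only: root_poly_def power_mult_distrib)
  qed
  show "coeff ((root_poly \<Lambda>)\<^sup>2) 0 = 0" "coeff ((root_poly \<Lambda>)\<^sup>2) 1 = 0"
    unfolding e coeff_monom_mult by auto
qed

lemma defect_gap:
  assumes "finite \<Lambda>"
  shows "defect \<Lambda> (gap n \<mu> \<Lambda>) = (\<Sum>i<n. (\<mu> i * (\<Prod>y\<in>\<Lambda>. \<mu> i - y))\<^sup>2)"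
proof -
  have "(\<Sum>x\<in>\<Lambda>. poly ((root_poly \<Lambda>)\<^sup>2) x) = 0"
    using assms by (intro sum.neutral) (auto simp: root_poly_props)
  then show ?thesis
    unfolding defect_def
    using assms
    by (subst sum_coeff_gap[OF root_poly_props(2-4)[OF assms]]) (simp add: root_poly_props(1))
qed

text \<open>
  Lagrange interpolation at the points of \<open>\<Lambda>\<close> and at \<open>0\<close>, the latter with multiplicity two. The degree
  \<open>card \<Lambda> + 1\<close> is the reason why the gaps of order \<open>2, \<dots>, q + 1\<close> suffice in the second part of the
  bound.
\<close>

lemma selecting_poly:
  assumes "finite \<Lambda>" "0 \<notin> \<Lambda>" "x \<in> \<Lambda>"
  obtains p :: "real poly" where "degree p \<le> card \<Lambda> + 1" "coeff p 0 = 0" "coeff p 1 = 0"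
    "poly p x = 1" "\<forall>y\<in>insert 0 \<Lambda> - {x}. poly p y = 0"
proof
  define R where "R = (\<Prod>y\<in>\<Lambda> - {x}. [:- y, 1:])"
  define c where "c = x\<^sup>2 * (\<Prod>y\<in>\<Lambda> - {x}. x - y)"
  define p where "p = Polynomial.smult (1 / c) (Polynomial.monom 1 2 * R)"
  have c: "c \<noteq> 0" using assms by (auto simp: c_def)
  have "degree R \<le> sum (degree \<circ> (\<lambda>x::real. [:- x, 1:])) (\<Lambda> - {x})"
    unfolding R_def using assms by (intro degree_prod_sum_le) auto
  also have "\<dots> = card \<Lambda> - 1" using assms by simp
  finally have "degree R \<le> card \<Lambda> - 1" .
  moreover have "card \<Lambda> \<ge> 1" using assms by (metis One_nat_def Suc_leI card_gt_0_iff empty_iff)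
  moreover have "degree p \<le> 2 + degree R"
    using degree_mult_le[of "Polynomial.monom 1 2" R] by (auto simp: p_def degree_monom_eq)
  ultimately show "degree p \<le> card \<Lambda> + 1" by linarith
  show "coeff p 0 = 0" "coeff p 1 = 0" by (auto simp: p_def coeff_monom_mult)
  have P: "poly p z = z\<^sup>2 * (\<Prod>y\<in>\<Lambda> - {x}. z - y) / c" for z
    by (simp add: p_def R_def poly_prod poly_monom)
  show "poly p x = 1" using c by (simp add: P c_def)
  show "\<forall>y\<in>insert 0 \<Lambda> - {x}. poly p y = 0"
    using assms by (auto simp: P)
qed

lemma poly_lipschitz:
  fixes p :: "real poly"
  obtains L where "L \<ge> 0" "\<forall>x y. \<bar>x\<bar> \<le> 1 \<longrightarrow> \<bar>y\<bar> \<le> 1 \<longrightarrow> \<bar>poly p x - poly p y\<bar> \<le> L * \<bar>x - y\<bar>"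
proof
  define L where "L = (\<Sum>r\<le>degree p. \<bar>coeff p r\<bar> * real r)"
  show "L \<ge> 0" by (auto simp: L_def intro: sum_nonneg)
  show "\<forall>x y. \<bar>x\<bar> \<le> 1 \<longrightarrow> \<bar>y\<bar> \<le> 1 \<longrightarrow> \<bar>poly p x - poly p y\<bar> \<le> L * \<bar>x - y\<bar>"
  proof (intro allI impI)
    fix x y :: real assume xy: "\<bar>x\<bar> \<le> 1" "\<bar>y\<bar> \<le> 1"
    have pow: "\<bar>x ^ r - y ^ r\<bar> \<le> real r * \<bar>x - y\<bar>" for r
      using norm_power_diff[of x y r] xy by auto
    have "poly p x - poly p y = (\<Sum>r\<le>degree p. coeff p r * (x ^ r - y ^ r))"
      by (simp add: poly_altdef sum_subtractf right_diff_distrib)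
    also have "\<bar>\<dots>\<bar> \<le> (\<Sum>r\<le>degree p. \<bar>coeff p r * (x ^ r - y ^ r)\<bar>)" by (rule sum_abs)
    also have "\<dots> \<le> (\<Sum>r\<le>degree p. \<bar>coeff p r\<bar> * (real r * \<bar>x - y\<bar>))"
      by (intro sum_mono) (auto simp: abs_mult intro!: mult_left_mono pow)
    also have "\<dots> = L * \<bar>x - y\<bar>" by (simp add: L_def sum_distrib_right mult.assoc)
    finally show "\<bar>poly p x - poly p y\<bar> \<le> L * \<bar>x - y\<bar>" .
  qed
qed

text \<open>
  A plain Lipschitz bound, summed over all \<open>n\<close> eigenvalues, would cost a factor that grows with
  \<open>n\<close>. The additional factor \<open>\<bar>x\<bar>\<close> makes the sum a scalar product, to which Cauchy-Schwarz applies;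
  near the origin it comes from the double zero of \<open>p\<close>, elsewhere from \<open>\<bar>x\<bar> \<ge> d\<close>.
\<close>

lemma poly_weighted_lipschitz:
  fixes p :: "real poly"
  assumes "coeff p 0 = 0" "coeff p 1 = 0" "d > 0"
  obtains L where "L \<ge> 0"
    "\<forall>x y. \<bar>x\<bar> \<le> 1 \<longrightarrow> \<bar>y\<bar> \<le> 1 \<longrightarrow> y = 0 \<or> d \<le> \<bar>x\<bar> \<longrightarrow>
      \<bar>poly p x - poly p y\<bar> \<le> L * (\<bar>x\<bar> * \<bar>x - y\<bar>)"
proof -
  obtain r where r: "p = pCons 0 r" using assms(1) by (cases p) auto
  have r0: "poly r 0 = 0" using assms(2) by (simp add: r poly_0_coeff_0)
  obtain L1 where L1: "L1 \<ge> 0"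
    "\<forall>x y. \<bar>x\<bar> \<le> 1 \<longrightarrow> \<bar>y\<bar> \<le> 1 \<longrightarrow> \<bar>poly r x - poly r y\<bar> \<le> L1 * \<bar>x - y\<bar>"
    by (rule poly_lipschitz[of r])
  obtain L2 where L2: "L2 \<ge> 0"
    "\<forall>x y. \<bar>x\<bar> \<le> 1 \<longrightarrow> \<bar>y\<bar> \<le> 1 \<longrightarrow> \<bar>poly p x - poly p y\<bar> \<le> L2 * \<bar>x - y\<bar>"
    by (rule poly_lipschitz[of p])
  note L1 = L1(1) L1(2)[rule_format] and L2 = L2(1) L2(2)[rule_format]
  show thesis
  proof (rule that[of "L1 + L2 / d"])
    show "0 \<le> L1 + L2 / d" using L1(1) L2(1) assms by simp
    show "\<forall>x y. \<bar>x\<bar> \<le> 1 \<longrightarrow> \<bar>y\<bar> \<le> 1 \<longrightarrow> y = 0 \<or> d \<le> \<bar>x\<bar> \<longrightarrow>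
      \<bar>poly p x - poly p y\<bar> \<le> (L1 + L2 / d) * (\<bar>x\<bar> * \<bar>x - y\<bar>)"
    proof (intro allI impI)
      fix x y :: real assume xy: "\<bar>x\<bar> \<le> 1" "\<bar>y\<bar> \<le> 1" "y = 0 \<or> d \<le> \<bar>x\<bar>"
      from xy(3) have "\<bar>poly p x - poly p y\<bar> \<le> L1 * (\<bar>x\<bar> * \<bar>x - y\<bar>) \<or>
        \<bar>poly p x - poly p y\<bar> \<le> L2 / d * (\<bar>x\<bar> * \<bar>x - y\<bar>)"
      proof
        assume "y = 0"
        moreover have "\<bar>poly r x\<bar> \<le> L1 * \<bar>x\<bar>" using L1(2)[OF xy(1), of 0] r0 by simp
        then have "\<bar>x\<bar> * \<bar>poly r x\<bar> \<le> \<bar>x\<bar> * (L1 * \<bar>x\<bar>)" by (rule mult_left_mono) simp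
        ultimately show ?thesis by (simp add: r abs_mult algebra_simps)
      next
        assume d: "d \<le> \<bar>x\<bar>"
        have "L2 * \<bar>x - y\<bar> * 1 \<le> L2 * \<bar>x - y\<bar> * (\<bar>x\<bar> / d)"
          using d assms L2(1) by (intro mult_left_mono) auto
        then show ?thesis using L2(2)[OF xy(1,2)] by (auto simp: field_simps)
      qed
      moreover have "0 \<le> L1 * (\<bar>x\<bar> * \<bar>x - y\<bar>)" "0 \<le> L2 / d * (\<bar>x\<bar> * \<bar>x - y\<bar>)"
        using L1(1) L2(1) assms by auto
      ultimately show "\<bar>poly p x - poly p y\<bar> \<le> (L1 + L2 / d) * (\<bar>x\<bar> * \<bar>x - y\<bar>)"
        unfolding distrib_right by linarith
    qed
  qed
qed

lemma finite_separated:
  fixes S :: "real set"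
  assumes "finite S"
  obtains d where "d > 0" "d \<le> 1" "\<forall>x\<in>S. \<forall>y\<in>S. x \<noteq> y \<longrightarrow> d \<le> \<bar>x - y\<bar>"
proof
  define T where "T = insert 1 ((\<lambda>(x, y). \<bar>x - y\<bar>) ` {(x, y) \<in> S \<times> S. x \<noteq> y})"
  have "finite {(x, y) \<in> S \<times> S. x \<noteq> y}"
    by (rule finite_subset[of _ "S \<times> S"]) (use assms in auto)
  then have f: "finite T" unfolding T_def by simp
  have "\<forall>t\<in>T. 0 < t" by (auto simp: T_def)
  then show "0 < Min T" using f by (subst Min_gr_iff) (auto simp: T_def)
  show "Min T \<le> 1" using f by (intro Min_le) (auto simp: T_def)
  show "\<forall>x\<in>S. \<forall>y\<in>S. x \<noteq> y \<longrightarrow> Min T \<le> \<bar>x - y\<bar>"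
    using f by (auto intro!: Min_le simp: T_def)
qed

text \<open>
  Here \<open>\<nu> i\<close> stands for the point near \<open>\<mu> i\<close>. The number of indices attached to \<open>x\<close> is
  \<open>\<Sum>i. p (\<nu> i)\<close> for the selecting polynomial \<open>p\<close>. Replacing \<open>\<nu>\<close> by \<open>\<mu>\<close> costs the distance of the two
  vectors, and then replacing \<open>\<mu>\<close> by \<open>\<Lambda>\<close>, where the sum is \<open>1\<close>, costs a combination of the gaps.
\<close>

lemma count_near:
  assumes fin: "finite \<Lambda>" and z: "0 \<notin> \<Lambda>" and x: "x \<in> \<Lambda>"
    and b: "\<forall>y\<in>\<Lambda>. \<bar>y\<bar> \<le> 1" and d: "d > 0"
  obtains B where "B \<ge> 0"
    "\<forall>n \<mu> \<nu>. (\<Sum>i<n. (\<mu> i)\<^sup>2) = 1 \<longrightarrow> (\<forall>i<n. \<nu> i \<in> insert 0 \<Lambda> \<and> (\<nu> i = 0 \<or> d \<le> \<bar>\<mu> i\<bar>)) \<longrightarrow>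
      \<bar>real (card {i. i < n \<and> \<nu> i = x}) - 1\<bar> \<le>
        B * (sqrt (\<Sum>i<n. (\<mu> i - \<nu> i)\<^sup>2) + (\<Sum>r = 2..card \<Lambda> + 1. \<bar>gap n \<mu> \<Lambda> r\<bar>))"
proof -
  obtain p :: "real poly" where p: "degree p \<le> card \<Lambda> + 1" "coeff p 0 = 0" "coeff p 1 = 0"
    "poly p x = 1" "\<forall>y\<in>insert 0 \<Lambda> - {x}. poly p y = 0"
    by (rule selecting_poly[OF fin z x])
  obtain L where L: "L \<ge> 0"
    "\<forall>x y. \<bar>x\<bar> \<le> 1 \<longrightarrow> \<bar>y\<bar> \<le> 1 \<longrightarrow> y = 0 \<or> d \<le> \<bar>x\<bar> \<longrightarrow>
      \<bar>poly p x - poly p y\<bar> \<le> L * (\<bar>x\<bar> * \<bar>x - y\<bar>)"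
    by (rule poly_weighted_lipschitz[OF p(2,3) d])
  note L = L(1) L(2)[rule_format]
  define D where "D = (\<Sum>r = 2..card \<Lambda> + 1. \<bar>coeff p r\<bar>)"
  have D: "D \<ge> 0" by (auto simp: D_def intro: sum_nonneg)
  show thesis
  proof (rule that[of "L + D"])
    show "0 \<le> L + D" using L(1) D by simp
    show "\<forall>n \<mu> \<nu>. (\<Sum>i<n. (\<mu> i)\<^sup>2) = 1 \<longrightarrow> (\<forall>i<n. \<nu> i \<in> insert 0 \<Lambda> \<and> (\<nu> i = 0 \<or> d \<le> \<bar>\<mu> i\<bar>)) \<longrightarrow>
      \<bar>real (card {i. i < n \<and> \<nu> i = x}) - 1\<bar> \<le>
        (L + D) * (sqrt (\<Sum>i<n. (\<mu> i - \<nu> i)\<^sup>2) + (\<Sum>r = 2..card \<Lambda> + 1. \<bar>gap n \<mu> \<Lambda> r\<bar>))"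
    proof (intro allI impI)
      fix n and \<mu> \<nu> :: "nat \<Rightarrow> real"
      assume s: "(\<Sum>i<n. (\<mu> i)\<^sup>2) = 1"
        and near: "\<forall>i<n. \<nu> i \<in> insert 0 \<Lambda> \<and> (\<nu> i = 0 \<or> d \<le> \<bar>\<mu> i\<bar>)"
      let ?G = "\<Sum>r = 2..card \<Lambda> + 1. \<bar>gap n \<mu> \<Lambda> r\<bar>"
      let ?E = "sqrt (\<Sum>i<n. (\<mu> i - \<nu> i)\<^sup>2)"
      have \<mu>1: "\<bar>\<mu> i\<bar> \<le> 1" if "i < n" for i
      proof -
        have "(\<mu> i)\<^sup>2 \<le> (\<Sum>i<n. (\<mu> i)\<^sup>2)" using that by (intro member_le_sum) auto
        then show ?thesis using s by (simp add: abs_square_le_1)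
      qed
      have "real (card {i. i < n \<and> \<nu> i = x}) = (\<Sum>i<n. if \<nu> i = x then 1 else 0)"
        by (subst sum.inter_filter[symmetric]) auto
      also have "\<dots> = (\<Sum>i<n. poly p (\<nu> i))"
        using near p(4,5) by (intro sum.cong) auto
      finally have c: "real (card {i. i < n \<and> \<nu> i = x}) = (\<Sum>i<n. poly p (\<nu> i))" .
      have "(\<Sum>y\<in>\<Lambda>. poly p y) = (\<Sum>y\<in>{x}. poly p y)"
        using fin x p(5) by (intro sum.mono_neutral_right) auto
      then have one: "(\<Sum>y\<in>\<Lambda>. poly p y) = 1" using p(4) by simp
      have "\<bar>(\<Sum>i<n. poly p (\<mu> i)) - (\<Sum>i<n. poly p (\<nu> i))\<bar> \<le> (\<Sum>i<n. \<bar>poly p (\<mu> i) - poly p (\<nu> i)\<bar>)"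
        unfolding sum_subtractf[symmetric] by (rule sum_abs)
      also have "\<dots> \<le> (\<Sum>i<n. L * (\<bar>\<mu> i\<bar> * \<bar>\<mu> i - \<nu> i\<bar>))"
        using near b \<mu>1 by (intro sum_mono L(2)) auto
      also have "\<dots> = L * (\<Sum>i<n. \<bar>\<mu> i\<bar> * \<bar>\<mu> i - \<nu> i\<bar>)" by (simp add: sum_distrib_left)
      also have "\<dots> \<le> L * (sqrt (\<Sum>i<n. (\<mu> i)\<^sup>2) * ?E)"
        using L2_set_mult_ineq[of \<mu> "\<lambda>i. \<mu> i - \<nu> i" "{..<n}"] L(1)
        by (intro mult_left_mono) (auto simp: L2_set_def)
      finally have 1: "\<bar>(\<Sum>i<n. poly p (\<mu> i)) - (\<Sum>i<n. poly p (\<nu> i))\<bar> \<le> L * ?E" by (simp add: s)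
      have "\<bar>(\<Sum>i<n. poly p (\<mu> i)) - 1\<bar> = \<bar>\<Sum>r = 2..card \<Lambda> + 1. coeff p r * gap n \<mu> \<Lambda> r\<bar>"
        using sum_coeff_gap[OF p(1-3), of n \<mu> \<Lambda>] one by simp
      also have "\<dots> \<le> (\<Sum>r = 2..card \<Lambda> + 1. \<bar>coeff p r\<bar> * \<bar>gap n \<mu> \<Lambda> r\<bar>)"
        by (rule order_trans[OF sum_abs]) (simp add: abs_mult)
      also have "\<dots> \<le> (\<Sum>r = 2..card \<Lambda> + 1. D * \<bar>gap n \<mu> \<Lambda> r\<bar>)"
        unfolding D_def by (intro sum_mono mult_right_mono member_le_sum) auto
      finally have 2: "\<bar>(\<Sum>i<n. poly p (\<mu> i)) - 1\<bar> \<le> D * ?G" by (simp only: sum_distrib_left)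
      have "0 \<le> L * ?G" "0 \<le> D * ?E" using L(1) D by (auto intro!: mult_nonneg_nonneg sum_nonneg)
      with 1 2 show "\<bar>real (card {i. i < n \<and> \<nu> i = x}) - 1\<bar> \<le> (L + D) * (?E + ?G)"
        unfolding c distrib_left distrib_right by linarith
    qed
  qed
qed

text \<open>
  Either the bound is so large that any coupling proves it, or \<open>\<sigma>\<close> pairs each limiting coefficient
  with an eigenvalue of its own, the remaining eigenvalues being paired with \<open>0\<close>; the expression under
  the root is the squared Euclidean distance of the paired coefficient vectors.
\<close>

definition matching_constant :: "real set \<Rightarrow> real \<Rightarrow> bool" where
  "matching_constant \<Lambda> K \<longleftrightarrow> (\<forall>n \<mu>. (\<Sum>i<n. (\<mu> i)\<^sup>2) = 1 \<longrightarrow>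
     4 \<le> K * rate \<Lambda> (gap n \<mu> \<Lambda>) \<or>
     (\<exists>\<sigma>. inj_on \<sigma> \<Lambda> \<and> \<sigma> ` \<Lambda> \<subseteq> {..<n} \<and>
        sqrt ((\<Sum>x\<in>\<Lambda>. (\<mu> (\<sigma> x) - x)\<^sup>2) + (\<Sum>i\<in>{..<n} - \<sigma> ` \<Lambda>. (\<mu> i)\<^sup>2)) \<le> K * rate \<Lambda> (gap n \<mu> \<Lambda>)))"

lemma near_root:
  fixes d t :: real
  assumes fin: "finite S" and d: "0 < d" and sep: "\<forall>x\<in>S. \<forall>y\<in>S. x \<noteq> y \<longrightarrow> d \<le> \<bar>x - y\<bar>"
    and small: "\<bar>\<Prod>y\<in>S. t - y\<bar> < (d / 2) ^ card S"
  obtains y where "y \<in> S" "\<forall>x\<in>S. x \<noteq> y \<longrightarrow> d / 2 \<le> \<bar>t - x\<bar>"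
    "\<bar>t - y\<bar> * (d / 2) ^ (card S - 1) \<le> \<bar>\<Prod>y\<in>S. t - y\<bar>"
proof -
  have "\<exists>y\<in>S. \<bar>t - y\<bar> < d / 2"
  proof (rule ccontr)
    assume "\<not> ?thesis"
    then have "(\<Prod>y\<in>S. d / 2) \<le> (\<Prod>y\<in>S. \<bar>t - y\<bar>)" using d by (intro prod_mono) auto
    then show False using small by (simp add: abs_prod)
  qed
  then obtain y where y: "y \<in> S" "\<bar>t - y\<bar> < d / 2" by blast
  have far: "d / 2 \<le> \<bar>t - x\<bar>" if "x \<in> S" "x \<noteq> y" for x
    using sep[rule_format, of x y] that y by linarith
  have "(\<Prod>x\<in>S - {y}. d / 2) \<le> (\<Prod>x\<in>S - {y}. \<bar>t - x\<bar>)" using d far by (intro prod_mono) auto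
  then have "(d / 2) ^ (card S - 1) \<le> (\<Prod>x\<in>S - {y}. \<bar>t - x\<bar>)" using y fin by simp
  then have "\<bar>t - y\<bar> * (d / 2) ^ (card S - 1) \<le> \<bar>t - y\<bar> * (\<Prod>x\<in>S - {y}. \<bar>t - x\<bar>)"
    by (rule mult_left_mono) simp
  also have "\<dots> = \<bar>\<Prod>y\<in>S. t - y\<bar>"
    using prod.remove[OF fin y(1), of "\<lambda>x. \<bar>t - x\<bar>"] by (simp add: abs_prod)
  finally show thesis using that y far by blast
qed

text \<open>
  The number \<open>defect \<Lambda> (gap n \<mu> \<Lambda>)\<close> is the sum over \<open>i\<close> of the squared products of the distances of
  \<open>\<mu> i\<close> to the points of \<open>insert 0 \<Lambda>\<close>. When it is small, every \<open>\<mu> i\<close> has exactly one near point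
  \<open>\<nu> i\<close>, and since the other factors are bounded below, it controls the squared distance of \<open>\<mu>\<close> and
  \<open>\<nu>\<close>. By \<open>count_near\<close> the number of indices attached to a point of \<open>\<Lambda>\<close> then differs from \<open>1\<close> by less
  than \<open>1\<close>. Being an integer it is \<open>1\<close>, which defines \<open>\<sigma>\<close>.
\<close>

lemma matching_constant_exists:
  assumes fin: "finite \<Lambda>" and z: "0 \<notin> \<Lambda>" and one: "(\<Sum>x\<in>\<Lambda>. x\<^sup>2) = 1"
  obtains K where "K > 0" "matching_constant \<Lambda> K"
proof -
  have b: "\<bar>y\<bar> \<le> 1" if "y \<in> \<Lambda>" for y
  proof -
    have "y\<^sup>2 \<le> (\<Sum>x\<in>\<Lambda>. x\<^sup>2)" using that fin by (intro member_le_sum) auto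
    then show ?thesis using one by (simp add: abs_square_le_1)
  qed
  then have ball_b: "\<forall>y\<in>\<Lambda>. \<bar>y\<bar> \<le> 1" by simp
  define S where "S = insert 0 \<Lambda>"
  have finS: "finite S" and cS: "card S = card \<Lambda> + 1" using fin z by (auto simp: S_def)
  obtain d where d: "d > 0" "d \<le> 1" "\<forall>x\<in>S. \<forall>y\<in>S. x \<noteq> y \<longrightarrow> d \<le> \<bar>x - y\<bar>"
    by (rule finite_separated[OF finS])
  have d2: "d / 2 > 0" using d by simp
  have "\<forall>x\<in>\<Lambda>. \<exists>B\<ge>0. \<forall>n \<mu> \<nu>. (\<Sum>i<n. (\<mu> i)\<^sup>2) = 1 \<longrightarrow>
      (\<forall>i<n. \<nu> i \<in> insert 0 \<Lambda> \<and> (\<nu> i = 0 \<or> d / 2 \<le> \<bar>\<mu> i\<bar>)) \<longrightarrow>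
      \<bar>real (card {i. i < n \<and> \<nu> i = x}) - 1\<bar> \<le>
        B * (sqrt (\<Sum>i<n. (\<mu> i - \<nu> i)\<^sup>2) + (\<Sum>r = 2..card \<Lambda> + 1. \<bar>gap n \<mu> \<Lambda> r\<bar>))"
    (is "\<forall>x\<in>\<Lambda>. \<exists>B\<ge>0. ?Q x B")
  proof
    fix x assume "x \<in> \<Lambda>"
    obtain B where "B \<ge> 0" "?Q x B"
      by (rule count_near[OF fin z \<open>x \<in> \<Lambda>\<close> ball_b d2])
    then show "\<exists>B\<ge>0. ?Q x B" by blast
  qed
  then have "\<exists>Bf. \<forall>x\<in>\<Lambda>. Bf x \<ge> 0 \<and> ?Q x (Bf x)" by (rule bchoice)
  then obtain Bf where Bf: "\<And>x. x \<in> \<Lambda> \<Longrightarrow> Bf x \<ge> 0" "\<And>x. x \<in> \<Lambda> \<Longrightarrow> ?Q x (Bf x)" by blast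
  define B where "B = (\<Sum>x\<in>\<Lambda>. Bf x)"
  have BB: "B \<ge> 0" "\<And>x. x \<in> \<Lambda> \<Longrightarrow> Bf x \<le> B"
    using Bf(1) fin by (auto simp: B_def intro: sum_nonneg member_le_sum)
  define M where "M = (d / 2) ^ card \<Lambda>"
  have M: "0 < M" "M \<le> 1" using d by (auto simp: M_def intro!: power_le_one)
  \<comment> \<open>The first threshold yields the near points, the second one pushes the error of the counts below \<open>1\<close>.\<close>
  define \<epsilon> where "\<epsilon> = min ((d / 2) ^ card S) (M / (B + 1))"
  have \<epsilon>: "\<epsilon> > 0" using d2 M BB by (auto simp: \<epsilon>_def)
  define K where "K = max (4 / \<epsilon>) (1 / M)"
  have K: "K > 0" using M by (auto simp: K_def less_max_iff_disj)
  have "matching_constant \<Lambda> K"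
    unfolding matching_constant_def
  proof (intro allI impI)
    fix n and \<mu> :: "nat \<Rightarrow> real" assume s: "(\<Sum>i<n. (\<mu> i)\<^sup>2) = 1"
    define R where "R = rate \<Lambda> (gap n \<mu> \<Lambda>)"
    define \<Delta> where "\<Delta> = (\<Sum>i<n. (\<Prod>y\<in>S. \<mu> i - y)\<^sup>2)"
    have \<Delta>: "defect \<Lambda> (gap n \<mu> \<Lambda>) = \<Delta>"
      unfolding defect_gap[OF fin] \<Delta>_def S_def using fin z by simp
    have \<Delta>0: "\<Delta> \<ge> 0" by (auto simp: \<Delta>_def intro: sum_nonneg)
    define G where "G = (\<Sum>r = 2..card \<Lambda> + 1. \<bar>gap n \<mu> \<Lambda> r\<bar>)"
    have G0: "G \<ge> 0" by (auto simp: G_def intro: sum_nonneg)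
    have "G \<le> (\<Sum>r = 2..card \<Lambda> + 1. 2 ^ (r - 1) * fact (r - 1) * \<bar>gap n \<mu> \<Lambda> r\<bar>)"
      unfolding G_def
    proof (rule sum_mono)
      fix r :: nat
      have "(1::real) * 1 \<le> 2 ^ (r - 1) * fact (r - 1)" by (rule mult_mono) auto
      then show "\<bar>gap n \<mu> \<Lambda> r\<bar> \<le> 2 ^ (r - 1) * fact (r - 1) * \<bar>gap n \<mu> \<Lambda> r\<bar>"
        using mult_right_mono[of 1 "2 ^ (r - 1) * fact (r - 1)" "\<bar>gap n \<mu> \<Lambda> r\<bar>"] by simp
    qed
    then have RG: "sqrt \<Delta> + G \<le> R" by (simp add: R_def rate_def \<Delta>)
    show "4 \<le> K * rate \<Lambda> (gap n \<mu> \<Lambda>) \<or>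
     (\<exists>\<sigma>. inj_on \<sigma> \<Lambda> \<and> \<sigma> ` \<Lambda> \<subseteq> {..<n} \<and>
        sqrt ((\<Sum>x\<in>\<Lambda>. (\<mu> (\<sigma> x) - x)\<^sup>2) + (\<Sum>i\<in>{..<n} - \<sigma> ` \<Lambda>. (\<mu> i)\<^sup>2)) \<le> K * rate \<Lambda> (gap n \<mu> \<Lambda>))"
      unfolding R_def[symmetric]
    proof (cases "\<epsilon> \<le> R")
      case True
      have "4 = 4 / \<epsilon> * \<epsilon>" using \<epsilon> by simp
      also have "\<dots> \<le> K * R" using True \<epsilon> K by (intro mult_mono) (auto simp: K_def)
      finally show "4 \<le> K * R \<or> (\<exists>\<sigma>. inj_on \<sigma> \<Lambda> \<and> \<sigma> ` \<Lambda> \<subseteq> {..<n} \<and>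
        sqrt ((\<Sum>x\<in>\<Lambda>. (\<mu> (\<sigma> x) - x)\<^sup>2) + (\<Sum>i\<in>{..<n} - \<sigma> ` \<Lambda>. (\<mu> i)\<^sup>2)) \<le> K * R)" ..
    next
      case False
      then have small: "sqrt \<Delta> + G < \<epsilon>" using RG by simp
      have "\<exists>y. y \<in> S \<and> (\<forall>x\<in>S. x \<noteq> y \<longrightarrow> d / 2 \<le> \<bar>\<mu> i - x\<bar>) \<and> \<bar>\<mu> i - y\<bar> * M \<le> \<bar>\<Prod>y\<in>S. \<mu> i - y\<bar>"
        if i: "i < n" for i
      proof -
        have "(\<Prod>y\<in>S. \<mu> i - y)\<^sup>2 \<le> \<Delta>" unfolding \<Delta>_def using i by (intro member_le_sum) auto
        then have "\<bar>\<Prod>y\<in>S. \<mu> i - y\<bar> \<le> sqrt \<Delta>" using real_le_rsqrt by fastforce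
        also have "\<dots> < (d / 2) ^ card S" using small G0 by (auto simp: \<epsilon>_def)
        finally have lt: "\<bar>\<Prod>y\<in>S. \<mu> i - y\<bar> < (d / 2) ^ card S" .
        obtain y where "y \<in> S" "\<forall>x\<in>S. x \<noteq> y \<longrightarrow> d / 2 \<le> \<bar>\<mu> i - x\<bar>"
          "\<bar>\<mu> i - y\<bar> * (d / 2) ^ (card S - 1) \<le> \<bar>\<Prod>y\<in>S. \<mu> i - y\<bar>"
          by (rule near_root[OF finS d(1) d(3) lt])
        then show ?thesis using cS by (auto simp: M_def)
      qed
      then obtain \<nu> where \<nu>: "\<And>i. i < n \<Longrightarrow> \<nu> i \<in> S"
        "\<And>i x. i < n \<Longrightarrow> x \<in> S \<Longrightarrow> x \<noteq> \<nu> i \<Longrightarrow> d / 2 \<le> \<bar>\<mu> i - x\<bar>"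
        "\<And>i. i < n \<Longrightarrow> \<bar>\<mu> i - \<nu> i\<bar> * M \<le> \<bar>\<Prod>y\<in>S. \<mu> i - y\<bar>" by metis
      define E where "E = (\<Sum>i<n. (\<mu> i - \<nu> i)\<^sup>2)"
      have "M\<^sup>2 * E \<le> \<Delta>"
        unfolding E_def \<Delta>_def sum_distrib_left
      proof (rule sum_mono)
        fix i assume "i \<in> {..<n}"
        then have "(\<bar>\<mu> i - \<nu> i\<bar> * M)\<^sup>2 \<le> \<bar>\<Prod>y\<in>S. \<mu> i - y\<bar>\<^sup>2"
          using \<nu>(3) M by (intro power_mono) auto
        then show "M\<^sup>2 * (\<mu> i - \<nu> i)\<^sup>2 \<le> (\<Prod>y\<in>S. \<mu> i - y)\<^sup>2" by (simp add: power_mult_distrib mult.commute)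
      qed
      then have "sqrt (M\<^sup>2 * E) \<le> sqrt \<Delta>" by simp
      then have ME: "M * sqrt E \<le> sqrt \<Delta>" using M by (simp add: real_sqrt_mult)
      then have E: "sqrt E \<le> 1 / M * sqrt \<Delta>" using M by (simp add: field_simps)
      have "(\<Sum>i<n. (\<mu> i - \<nu> i)\<^sup>2) = E" by (simp add: E_def)
      have cnt: "card {i. i < n \<and> \<nu> i = x} = 1" if x: "x \<in> \<Lambda>" for x
      proof -
        have "\<forall>i<n. \<nu> i \<in> insert 0 \<Lambda> \<and> (\<nu> i = 0 \<or> d / 2 \<le> \<bar>\<mu> i\<bar>)"
          using \<nu>(1) \<nu>(2)[of _ 0] by (auto simp: S_def)
        then have "\<bar>real (card {i. i < n \<and> \<nu> i = x}) - 1\<bar> \<le> Bf x * (sqrt E + G)"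
          using Bf(2)[OF x] s unfolding E_def G_def by blast
        also have "\<dots> \<le> B * (sqrt E + G)"
          using BB(2)[OF x] G0 by (intro mult_right_mono) (auto simp: E_def intro!: add_nonneg_nonneg sum_nonneg)
        also have "\<dots> < 1"
        proof -
          have "M * G \<le> 1 * G" using M G0 by (intro mult_right_mono) auto
          then have "M * (sqrt E + G) \<le> sqrt \<Delta> + G" using ME by (simp add: distrib_left)
          also have "\<dots> < M / (B + 1)" using small by (simp add: \<epsilon>_def)
          finally have "M * (sqrt E + G) < M * (1 / (B + 1))" by simp
          then have *: "sqrt E + G < 1 / (B + 1)" using M(1) by (rule mult_left_less_imp_less[OF _ less_imp_le])
          have "B * (sqrt E + G) \<le> B * (1 / (B + 1))" using * BB by (intro mult_left_mono) auto
          also have "\<dots> < 1" using BB by (simp add: field_simps)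
          finally show ?thesis .
        qed
        finally show ?thesis by linarith
      qed
      then have "\<forall>x\<in>\<Lambda>. \<exists>i. {i. i < n \<and> \<nu> i = x} = {i}" by (metis card_1_singletonE)
      then obtain \<sigma> where \<sigma>: "\<And>x. x \<in> \<Lambda> \<Longrightarrow> {i. i < n \<and> \<nu> i = x} = {\<sigma> x}" by metis
      have \<sigma>1: "\<sigma> x < n" "\<nu> (\<sigma> x) = x" if "x \<in> \<Lambda>" for x using \<sigma>[OF that] by auto
      have inj: "inj_on \<sigma> \<Lambda>" using \<sigma>1 by (metis inj_onI)
      have sub: "\<sigma> ` \<Lambda> \<subseteq> {..<n}" using \<sigma>1 by auto
      have \<nu>0: "\<nu> i = 0" if "i < n" "i \<notin> \<sigma> ` \<Lambda>" for i
        using \<nu>(1)[OF that(1)] \<sigma>[of "\<nu> i"] that by (auto simp: S_def)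
      have "E = (\<Sum>i\<in>\<sigma> ` \<Lambda>. (\<mu> i - \<nu> i)\<^sup>2) + (\<Sum>i\<in>{..<n} - \<sigma> ` \<Lambda>. (\<mu> i - \<nu> i)\<^sup>2)"
        unfolding E_def using sum.subset_diff[OF sub] by (simp add: add.commute)
      also have "(\<Sum>i\<in>\<sigma> ` \<Lambda>. (\<mu> i - \<nu> i)\<^sup>2) = (\<Sum>x\<in>\<Lambda>. (\<mu> (\<sigma> x) - x)\<^sup>2)"
        using inj \<sigma>1 by (simp add: sum.reindex)
      also have "(\<Sum>i\<in>{..<n} - \<sigma> ` \<Lambda>. (\<mu> i - \<nu> i)\<^sup>2) = (\<Sum>i\<in>{..<n} - \<sigma> ` \<Lambda>. (\<mu> i)\<^sup>2)"
        using \<nu>0 by (intro sum.cong) auto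
      finally have "E = (\<Sum>x\<in>\<Lambda>. (\<mu> (\<sigma> x) - x)\<^sup>2) + (\<Sum>i\<in>{..<n} - \<sigma> ` \<Lambda>. (\<mu> i)\<^sup>2)" .
      moreover have "sqrt E \<le> K * R"
      proof -
        have "1 / M * sqrt \<Delta> \<le> K * R"
          using RG G0 M \<Delta>0 K by (intro mult_mono) (auto simp: K_def)
        then show ?thesis using E by linarith
      qed
      ultimately have "sqrt ((\<Sum>x\<in>\<Lambda>. (\<mu> (\<sigma> x) - x)\<^sup>2) + (\<Sum>i\<in>{..<n} - \<sigma> ` \<Lambda>. (\<mu> i)\<^sup>2)) \<le> K * R"
        by simp
      then show "4 \<le> K * R \<or> (\<exists>\<sigma>. inj_on \<sigma> \<Lambda> \<and> \<sigma> ` \<Lambda> \<subseteq> {..<n} \<and>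
        sqrt ((\<Sum>x\<in>\<Lambda>. (\<mu> (\<sigma> x) - x)\<^sup>2) + (\<Sum>i\<in>{..<n} - \<sigma> ` \<Lambda>. (\<mu> i)\<^sup>2)) \<le> K * R)"
        by (intro disjI2 exI[of _ \<sigma>] conjI inj sub)
    qed
  qed
  with K show thesis by (rule that)
qed


section \<open>Planar rotations of the Gaussian measure\<close>

definition gauss :: "real measure" where
  "gauss = density lborel (\<lambda>x. ennreal (std_normal_density x))"

definition gauss_pow :: "nat \<Rightarrow> (nat \<Rightarrow> real) measure" where
  "gauss_pow n = (\<Pi>\<^sub>M i\<in>{..<n}. gauss)"

lemma prob_space_gauss: "prob_space gauss"
  unfolding gauss_def by (rule prob_space_normal_density) simp

lemma sets_gauss [measurable_cong, simp]: "sets gauss = sets borel"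
  and space_gauss [simp]: "space gauss = UNIV"
  by (auto simp: gauss_def)

lemma sets_gauss_pow [measurable_cong]: "sets (gauss_pow n) = sets (\<Pi>\<^sub>M i\<in>{..<n}. borel)"
  unfolding gauss_pow_def by (intro sets_PiM_cong) auto

lemma space_gauss_pow: "space (gauss_pow n) = {..<n} \<rightarrow>\<^sub>E UNIV"
  by (simp add: gauss_pow_def space_PiM)

interpretation gauss: product_sigma_finite "\<lambda>_::nat. gauss"
  by (intro product_sigma_finite.intro prob_space_imp_sigma_finite prob_space_gauss)

text \<open>
  The Gaussian density is constant on circles, so the claim is the rotation invariance of Lebesgue
  measure. For \<open>s \<noteq> 0\<close> the two coordinates can be substituted one after the other, with factors \<open>1 / s\<close>
  and \<open>s\<close> that cancel.
\<close>

lemma nn_integral_gauss_rotate: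
  fixes F :: "real \<Rightarrow> real \<Rightarrow> ennreal"
  assumes [measurable]: "(\<lambda>(x, y). F x y) \<in> borel_measurable (borel \<Otimes>\<^sub>M borel)"
    and cs: "c\<^sup>2 + s\<^sup>2 = 1" and s: "s \<noteq> 0"
  shows "(\<integral>\<^sup>+ a. \<integral>\<^sup>+ b. F (c * b - s * a) (s * b + c * a) \<partial>gauss \<partial>gauss) = (\<integral>\<^sup>+ a. \<integral>\<^sup>+ b. F b a \<partial>gauss \<partial>gauss)"
proof -
  define G where "G u v = ennreal (std_normal_density v) * (ennreal (std_normal_density u) * F u v)" for u v
  have [measurable]: "(\<lambda>(x, y). G x y) \<in> borel_measurable (borel \<Otimes>\<^sub>M borel)"
    unfolding G_def by measurable
  have dens: "(\<integral>\<^sup>+ a. \<integral>\<^sup>+ b. H b a \<partial>gauss \<partial>gauss) =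
      (\<integral>\<^sup>+ a. \<integral>\<^sup>+ b. ennreal (std_normal_density a) * (ennreal (std_normal_density b) * H b a) \<partial>lborel \<partial>lborel)"
    if [measurable]: "(\<lambda>(x, y). H x y) \<in> borel_measurable (borel \<Otimes>\<^sub>M borel)" for H :: "real \<Rightarrow> real \<Rightarrow> ennreal"
    unfolding gauss_def by (simp add: nn_integral_density nn_integral_cmult)
  have invariant: "ennreal (std_normal_density a) * (ennreal (std_normal_density b) * F (c * b - s * a) (s * b + c * a)) =
      G (c * b - s * a) (s * b + c * a)" for a b
  proof -
    have "(s * b + c * a)\<^sup>2 + (c * b - s * a)\<^sup>2 = (c\<^sup>2 + s\<^sup>2) * (a\<^sup>2 + b\<^sup>2)"
      by (simp add: power2_eq_square algebra_simps)
    then have "std_normal_density a * std_normal_density b =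
        std_normal_density (s * b + c * a) * std_normal_density (c * b - s * a)"
      by (simp add: std_normal_density_def cs flip: exp_add add_divide_distrib)
    then show ?thesis
      by (simp add: G_def ennreal_mult[symmetric] mult.assoc[symmetric])
  qed
  have "(\<integral>\<^sup>+ a. \<integral>\<^sup>+ b. F (c * b - s * a) (s * b + c * a) \<partial>gauss \<partial>gauss) =
      (\<integral>\<^sup>+ a. \<integral>\<^sup>+ b. G (c * b - s * a) (s * b + c * a) \<partial>lborel \<partial>lborel)"
    by (subst dens) (simp_all add: invariant)
  also have "\<dots> = (\<integral>\<^sup>+ a. \<integral>\<^sup>+ v. ennreal \<bar>1 / s\<bar> * G ((c * v - a) / s) v \<partial>lborel \<partial>lborel)"
  proof (rule nn_integral_cong)
    fix a :: real
    have e: "c * (- (c * a / s) + 1 / s * v) - s * a = (c * v - a) / s" for v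
    proof -
      have "c * (- (c * a / s) + 1 / s * v) - s * a = (c * v - (c\<^sup>2 + s\<^sup>2) * a) / s"
        using s by (simp add: field_simps power2_eq_square)
      then show ?thesis by (simp add: cs)
    qed
    have "(\<integral>\<^sup>+ b. G (c * b - s * a) (s * b + c * a) \<partial>lborel) = ennreal \<bar>1 / s\<bar> * (\<integral>\<^sup>+ v.
       G (c * (- (c * a / s) + 1 / s * v) - s * a) (s * (- (c * a / s) + 1 / s * v) + c * a) \<partial>lborel)"
      using s by (subst nn_integral_real_affine[where c = "1 / s" and t = "- (c * a / s)"]) auto
    also have "\<dots> = ennreal \<bar>1 / s\<bar> * (\<integral>\<^sup>+ v. G ((c * v - a) / s) v \<partial>lborel)"
      unfolding e using s by (simp add: field_simps)
    finally show "(\<integral>\<^sup>+ b. G (c * b - s * a) (s * b + c * a) \<partial>lborel) =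
        (\<integral>\<^sup>+ v. ennreal \<bar>1 / s\<bar> * G ((c * v - a) / s) v \<partial>lborel)"
      by (simp add: nn_integral_cmult)
  qed
  also have "\<dots> = (\<integral>\<^sup>+ v. \<integral>\<^sup>+ a. ennreal \<bar>1 / s\<bar> * G ((c * v - a) / s) v \<partial>lborel \<partial>lborel)"
    by (rule lborel_pair.Fubini') measurable
  also have "\<dots> = (\<integral>\<^sup>+ v. \<integral>\<^sup>+ u. G u v \<partial>lborel \<partial>lborel)"
  proof (rule nn_integral_cong)
    fix v :: real
    have "(\<integral>\<^sup>+ a. ennreal \<bar>1 / s\<bar> * G ((c * v - a) / s) v \<partial>lborel) =
       ennreal \<bar>- s\<bar> * (\<integral>\<^sup>+ u. ennreal \<bar>1 / s\<bar> * G ((c * v - (c * v + - s * u)) / s) v \<partial>lborel)"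
      using s by (subst nn_integral_real_affine[where c = "- s" and t = "c * v"]) auto
    also have "\<dots> = ennreal \<bar>- s\<bar> * ennreal \<bar>1 / s\<bar> * (\<integral>\<^sup>+ u. G u v \<partial>lborel)"
      using s by (simp add: nn_integral_cmult mult.assoc)
    also have "ennreal \<bar>- s\<bar> * ennreal \<bar>1 / s\<bar> = 1"
      using s by (simp add: ennreal_mult[symmetric])
    finally show "(\<integral>\<^sup>+ a. ennreal \<bar>1 / s\<bar> * G ((c * v - a) / s) v \<partial>lborel) = (\<integral>\<^sup>+ u. G u v \<partial>lborel)"
      by simp
  qed
  also have "\<dots> = (\<integral>\<^sup>+ a. \<integral>\<^sup>+ b. F b a \<partial>gauss \<partial>gauss)"
    by (subst dens) (simp_all add: G_def)
  finally show ?thesis .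
qed

lemma distr_eqI_nn_integral:
  assumes [measurable]: "T \<in> measurable N N"
    and "\<And>f :: _ \<Rightarrow> ennreal. f \<in> borel_measurable N \<Longrightarrow> (\<integral>\<^sup>+ x. f (T x) \<partial>N) = (\<integral>\<^sup>+ x. f x \<partial>N)"
  shows "distr N N T = N"
proof (rule measure_eqI)
  fix A assume "A \<in> sets (distr N N T)"
  then have [measurable]: "A \<in> sets N" by simp
  have "emeasure (distr N N T) A = (\<integral>\<^sup>+ x. indicator A x \<partial>distr N N T)" by simp
  also have "\<dots> = (\<integral>\<^sup>+ x. indicator A (T x) \<partial>N)" by (rule nn_integral_distr) measurable
  also have "\<dots> = (\<integral>\<^sup>+ x. indicator A x \<partial>N)" by (rule assms(2)) measurable
  finally show "emeasure (distr N N T) A = emeasure N A" by simp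
qed simp

lemma gauss_pow_Suc:
  assumes "f \<in> borel_measurable (gauss_pow (Suc n))"
  shows "(\<integral>\<^sup>+ x. f x \<partial>gauss_pow (Suc n)) = (\<integral>\<^sup>+ x. \<integral>\<^sup>+ y. f (x(n := y)) \<partial>gauss \<partial>gauss_pow n)"
  using assms unfolding gauss_pow_def lessThan_Suc
  by (intro gauss.product_nn_integral_insert) auto

text \<open>
  The coordinates \<open>i\<close> and \<open>j\<close> are integrated first, so that a rotation of their plane acts on the
  inner double integral only.
\<close>

lemma gauss_pow_two:
  assumes f: "f \<in> borel_measurable (gauss_pow n)" and ij: "i < n" "j < n" "i \<noteq> j"
  shows "(\<integral>\<^sup>+ x. f x \<partial>gauss_pow n) =
    (\<integral>\<^sup>+ x. \<integral>\<^sup>+ a. \<integral>\<^sup>+ b. f (x(j := a, i := b)) \<partial>gauss \<partial>gauss \<partial>(\<Pi>\<^sub>M k\<in>{..<n} - {i, j}. gauss))"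
proof -
  let ?K = "{..<n} - {i, j}"
  have eq: "{..<n} = insert i (insert j ?K)" using ij by auto
  have 1 [measurable]: "f \<in> borel_measurable (\<Pi>\<^sub>M k\<in>insert i (insert j ?K). gauss)"
    using f unfolding gauss_pow_def eq[symmetric] .
  have 2: "(\<lambda>x. \<integral>\<^sup>+ b. f (x(i := b)) \<partial>gauss) \<in> borel_measurable (\<Pi>\<^sub>M k\<in>insert j ?K. gauss)"
  proof -
    interpret prob_space gauss by (rule prob_space_gauss)
    show ?thesis by measurable
  qed
  show ?thesis
    unfolding gauss_pow_def
    apply (subst eq)
    apply (subst gauss.product_nn_integral_insert[OF _ _ 1])
      apply (use ij in auto)[2]
    apply (subst gauss.product_nn_integral_insert[OF _ _ 2])
    apply auto
    done
qed

definition plane_rot :: "nat \<Rightarrow> nat \<Rightarrow> real \<Rightarrow> real \<Rightarrow> (nat \<Rightarrow> real) \<Rightarrow> nat \<Rightarrow> real" where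
  "plane_rot i j c s x = x(j := s * x i + c * x j, i := c * x i - s * x j)"

lemma measurable_plane_rot:
  assumes "i < n" "j < n"
  shows "plane_rot i j c s \<in> measurable (gauss_pow n) (gauss_pow n)"
proof -
  have "(\<lambda>x. plane_rot i j c s x) \<in> measurable (\<Pi>\<^sub>M k\<in>{..<n}. borel) (\<Pi>\<^sub>M k\<in>{..<n}. borel)"
  proof (rule measurable_PiM_single')
    fix k assume "k \<in> {..<n}"
    then show "(\<lambda>x. plane_rot i j c s x k) \<in> measurable (\<Pi>\<^sub>M k\<in>{..<n}. borel) borel"
      using assms unfolding plane_rot_def
      by (cases "k = i"; cases "k = j") auto
  next
    show "(\<lambda>x. plane_rot i j c s x) \<in> space (\<Pi>\<^sub>M k\<in>{..<n}. borel) \<rightarrow> {..<n} \<rightarrow>\<^sub>E space borel"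
      using assms by (auto simp: space_PiM plane_rot_def PiE_def extensional_def)
  qed
  then show ?thesis by (simp cong: measurable_cong_sets add: sets_gauss_pow)
qed

lemma distr_plane_rot:
  assumes ij: "i < n" "j < n" "i \<noteq> j" and cs: "c\<^sup>2 + s\<^sup>2 = 1" "s \<noteq> 0"
  shows "distr (gauss_pow n) (gauss_pow n) (plane_rot i j c s) = gauss_pow n"
proof (rule distr_eqI_nn_integral)
  show m [measurable]: "plane_rot i j c s \<in> measurable (gauss_pow n) (gauss_pow n)"
    by (rule measurable_plane_rot) fact+
  fix f :: "(nat \<Rightarrow> real) \<Rightarrow> ennreal" assume f [measurable]: "f \<in> borel_measurable (gauss_pow n)"
  have e: "plane_rot i j c s (x(j := a, i := b)) = x(j := s * b + c * a, i := c * b - s * a)" for x a b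
    using ij by (auto simp: plane_rot_def)
  have "(\<integral>\<^sup>+ x. f (plane_rot i j c s x) \<partial>gauss_pow n) = (\<integral>\<^sup>+ x. \<integral>\<^sup>+ a. \<integral>\<^sup>+ b.
      f (x(j := s * b + c * a, i := c * b - s * a)) \<partial>gauss \<partial>gauss \<partial>(\<Pi>\<^sub>M k\<in>{..<n} - {i, j}. gauss))"
    by (subst gauss_pow_two[OF _ ij]) (simp_all add: e)
  also have "\<dots> = (\<integral>\<^sup>+ x. \<integral>\<^sup>+ a. \<integral>\<^sup>+ b. f (x(j := a, i := b)) \<partial>gauss \<partial>gauss \<partial>(\<Pi>\<^sub>M k\<in>{..<n} - {i, j}. gauss))"
  proof (rule nn_integral_cong)
    fix x assume x: "x \<in> space (\<Pi>\<^sub>M k\<in>{..<n} - {i, j}. gauss)"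
    have upd: "(\<lambda>(u, v). x(j := v, i := u)) \<in> measurable (borel \<Otimes>\<^sub>M borel) (gauss_pow n)"
    proof -
      have "(\<lambda>p. x(j := snd p, i := fst p)) \<in> measurable (borel \<Otimes>\<^sub>M borel) (\<Pi>\<^sub>M k\<in>{..<n}. borel)"
      proof (rule measurable_PiM_single')
        fix k assume "k \<in> {..<n}"
        show "(\<lambda>p. (x(j := snd p, i := fst p)) k) \<in> measurable (borel \<Otimes>\<^sub>M borel) borel"
          by (cases "k = i"; cases "k = j") auto
      next
        show "(\<lambda>p. x(j := snd p, i := fst p)) \<in> space (borel \<Otimes>\<^sub>M borel) \<rightarrow> {..<n} \<rightarrow>\<^sub>E space borel"
          using x ij by (auto simp: space_PiM PiE_def extensional_def)
      qed
      then show ?thesis by (simp cong: measurable_cong_sets add: sets_gauss_pow case_prod_beta)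
    qed
    have "(\<lambda>(u, v). f (x(j := v, i := u))) \<in> borel_measurable (borel \<Otimes>\<^sub>M borel)"
      using measurable_compose[OF upd f] by (simp add: case_prod_beta)
    from nn_integral_gauss_rotate[OF this cs]
    show "(\<integral>\<^sup>+ a. \<integral>\<^sup>+ b. f (x(j := s * b + c * a, i := c * b - s * a)) \<partial>gauss \<partial>gauss) =
        (\<integral>\<^sup>+ a. \<integral>\<^sup>+ b. f (x(j := a, i := b)) \<partial>gauss \<partial>gauss)" .
  qed
  also have "\<dots> = (\<integral>\<^sup>+ x. f x \<partial>gauss_pow n)"
    by (rule gauss_pow_two[OF f ij, symmetric])
  finally show "(\<integral>\<^sup>+ x. f (plane_rot i j c s x) \<partial>gauss_pow n) = (\<integral>\<^sup>+ x. f x \<partial>gauss_pow n)" .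
qed


section \<open>Diagonalisation by rotations\<close>

definition apply_mat :: "nat \<Rightarrow> real mat \<Rightarrow> (nat \<Rightarrow> real) \<Rightarrow> nat \<Rightarrow> real" where
  "apply_mat n U x = (\<lambda>k\<in>{..<n}. \<Sum>j<n. U $$ (k, j) * x j)"

text \<open>
  Invariance of the Gaussian measure is made part of the definition: it is established for planar
  rotations, and it passes to products and to block extensions. The matrices
  obtained in this way are enough to diagonalise a symmetric matrix.
\<close>

definition gauss_orth :: "nat \<Rightarrow> real mat set" where
  "gauss_orth n = {U \<in> carrier_mat n n. U * transpose_mat U = 1\<^sub>m n \<and>
     distr (gauss_pow n) (gauss_pow n) (apply_mat n U) = gauss_pow n}"

lemma symmetric_entry:
  assumes "A \<in> carrier_mat n n" "transpose_mat A = A" "i < n" "j < n"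
  shows "A $$ (i, j) = A $$ (j, i)"
  using assms by (metis carrier_matD index_transpose_mat(1))

text \<open>
  The characteristic polynomial has a complex root \<open>z\<close>. For an eigenvector \<open>y\<close> the Hermitian form
  \<open>\<Sum>i j. cnj (y i) * A i j * y j\<close> is real and equals \<open>z\<close> times the squared norm of \<open>y\<close>, so \<open>z\<close> is real.
  The real and the imaginary part of \<open>y\<close> are then solutions as well, and one of them does not vanish.
\<close>

lemma symmetric_eigenvector:
  assumes A: "A \<in> carrier_mat n n" and sym: "transpose_mat A = A" and n: "n > 0"
  obtains e :: real and x where "\<exists>i<n. x i \<noteq> 0" "\<forall>i<n. (\<Sum>j<n. A $$ (i, j) * x j) = e * x i"
proof -
  note A_sym = symmetric_entry[OF A sym]
  define C where "C = map_mat complex_of_real A"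
  have C: "C \<in> carrier_mat n n" using A by (simp add: C_def)
  have "degree (char_poly C) > 0" using degree_monic_char_poly[OF C] n by simp
  then have "\<not> constant (poly (char_poly C))" by (simp add: constant_degree)
  from fundamental_theorem_of_algebra[OF this] obtain z where "poly (char_poly C) z = 0" by blast
  then have "eigenvalue C z" using eigenvalue_root_char_poly[OF C] by blast
  then obtain v where v: "v \<in> carrier_vec n" "v \<noteq> 0\<^sub>v n" "C *\<^sub>v v = z \<cdot>\<^sub>v v"
    using C by (auto simp: eigenvalue_def eigenvector_def)
  define y where "y i = vec_index v i" for i
  have y: "(\<Sum>j<n. complex_of_real (A $$ (i, j)) * y j) = z * y i" if i: "i < n" for i
  proof -
    have "vec_index (C *\<^sub>v v) i = (\<Sum>j<n. complex_of_real (A $$ (i, j)) * y j)"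
      using i v(1) A by (simp add: C_def scalar_prod_def y_def atLeast0LessThan)
    then show ?thesis using i v by (simp add: y_def)
  qed
  obtain k where k: "k < n" "y k \<noteq> 0"
    using v(1,2) by (auto simp: y_def vec_eq_iff)
  define N where "N = (\<Sum>i<n. (cmod (y i))\<^sup>2)"
  have "0 < (cmod (y k))\<^sup>2" using k by simp
  also have "\<dots> \<le> N" unfolding N_def using k by (intro member_le_sum) auto
  finally have N: "N > 0" .
  define S where "S = (\<Sum>i<n. \<Sum>j<n. cnj (y i) * (complex_of_real (A $$ (i, j)) * y j))"
  have "S = (\<Sum>i<n. cnj (y i) * (z * y i))"
    unfolding S_def sum_distrib_left[symmetric] using y by simp
  also have "\<dots> = z * of_real N"
    by (simp add: N_def sum_distrib_left complex_norm_square mult_ac flip: of_real_power)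
  finally have S: "S = z * of_real N" .
  have "cnj S = (\<Sum>i<n. \<Sum>j<n. y i * (complex_of_real (A $$ (i, j)) * cnj (y j)))"
    by (simp add: S_def)
  also have "\<dots> = (\<Sum>j<n. \<Sum>i<n. y i * (complex_of_real (A $$ (i, j)) * cnj (y j)))"
    by (rule sum.swap)
  also have "\<dots> = S"
    unfolding S_def by (intro sum.cong refl) (simp add: A_sym mult_ac)
  finally have "cnj z * of_real N = z * of_real N" unfolding S by simp
  then have "cnj z = z" using N by simp
  then have z: "z = of_real (Re z)" by (simp add: complex_eq_iff)
  have Re: "(\<Sum>j<n. A $$ (i, j) * Re (y j)) = Re z * Re (y i)"
    and Im: "(\<Sum>j<n. A $$ (i, j) * Im (y j)) = Re z * Im (y i)" if "i < n" for i
    using arg_cong[OF y[OF that], of Re] arg_cong[OF y[OF that], of Im] arg_cong[OF z, of Im] by auto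
  have "Re (y k) \<noteq> 0 \<or> Im (y k) \<noteq> 0" using k by (auto simp: complex_eq_iff)
  then show thesis
  proof
    assume "Re (y k) \<noteq> 0"
    then show thesis using that[of "\<lambda>i. Re (y i)" "Re z"] k Re by blast
  next
    assume "Im (y k) \<noteq> 0"
    then show thesis using that[of "\<lambda>i. Im (y i)" "Re z"] k Im by blast
  qed
qed

lemma apply_mat_mult:
  assumes "U \<in> carrier_mat n n" "V \<in> carrier_mat n n"
  shows "apply_mat n (U * V) x = apply_mat n U (apply_mat n V x)"
proof (rule ext)
  fix k
  have "(\<Sum>j<n. (\<Sum>l<n. U $$ (k, l) * V $$ (l, j)) * x j) = (\<Sum>l<n. U $$ (k, l) * (\<Sum>j<n. V $$ (l, j) * x j))"
    unfolding sum_distrib_left sum_distrib_right by (subst sum.swap) (simp add: mult.assoc)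
  then show "apply_mat n (U * V) x k = apply_mat n U (apply_mat n V x) k"
    using assms by (simp add: apply_mat_def scalar_prod_def atLeast0LessThan)
qed

lemma apply_mat_cong: "(\<And>i. i < n \<Longrightarrow> x i = y i) \<Longrightarrow> apply_mat n U x = apply_mat n U y"
  by (auto simp: apply_mat_def fun_eq_iff)

lemma apply_mat_one: "k < n \<Longrightarrow> apply_mat n (1\<^sub>m n) x k = x k"
  by (simp add: apply_mat_def if_distrib[of "\<lambda>a. a * _"] cong: if_cong)

lemma apply_mat_smult: "k < n \<Longrightarrow> apply_mat n U (\<lambda>i. e * x i) k = e * apply_mat n U x k"
  by (simp add: apply_mat_def sum_distrib_left mult_ac)

lemma measurable_apply_mat [measurable]: "apply_mat n U \<in> measurable (gauss_pow n) (gauss_pow n)"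
proof -
  have "apply_mat n U \<in> measurable (\<Pi>\<^sub>M k\<in>{..<n}. borel) (\<Pi>\<^sub>M k\<in>{..<n}. borel)"
    unfolding apply_mat_def by measurable
  then show ?thesis by (simp cong: measurable_cong_sets add: sets_gauss_pow)
qed

lemma gauss_orthD:
  assumes "U \<in> gauss_orth n"
  shows "U \<in> carrier_mat n n" "U * transpose_mat U = 1\<^sub>m n" "transpose_mat U * U = 1\<^sub>m n"
    "distr (gauss_pow n) (gauss_pow n) (apply_mat n U) = gauss_pow n"
  using assms mat_mult_left_right_inverse[of U n "transpose_mat U"] by (auto simp: gauss_orth_def)

lemma gauss_orth_one: "1\<^sub>m n \<in> gauss_orth n"
proof -
  have "distr (gauss_pow n) (gauss_pow n) (apply_mat n (1\<^sub>m n)) = distr (gauss_pow n) (gauss_pow n) (\<lambda>x. x)"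
  proof (rule distr_cong)
    fix x assume x: "x \<in> space (gauss_pow n)"
    have "apply_mat n (1\<^sub>m n) x k = x k" for k
    proof (cases "k < n")
      case True
      then show ?thesis by (rule apply_mat_one)
    next
      case False
      then show ?thesis using x by (simp add: apply_mat_def space_gauss_pow PiE_def extensional_def)
    qed
    then show "apply_mat n (1\<^sub>m n) x = x" by blast
  qed auto
  then show ?thesis by (simp add: gauss_orth_def)
qed

lemma gauss_orth_mult:
  assumes U: "U \<in> gauss_orth n" and V: "V \<in> gauss_orth n"
  shows "U * V \<in> gauss_orth n"
proof -
  note [simp] = gauss_orthD(1)[OF U] gauss_orthD(1)[OF V]
  have "U * V * transpose_mat (U * V) = U * (V * transpose_mat V) * transpose_mat U"
    by (simp add: transpose_mult[of _ n n _ n] assoc_mult_mat[of _ n n _ n _ n] mult_carrier_mat[of _ n n _ n])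
  then have 1: "U * V * transpose_mat (U * V) = 1\<^sub>m n"
    by (simp add: gauss_orthD(2)[OF U] gauss_orthD(2)[OF V] right_mult_one_mat[of _ n n])
  have "apply_mat n (U * V) = apply_mat n U \<circ> apply_mat n V"
    by (rule ext) (simp add: apply_mat_mult)
  then have "distr (gauss_pow n) (gauss_pow n) (apply_mat n (U * V)) =
      distr (distr (gauss_pow n) (gauss_pow n) (apply_mat n V)) (gauss_pow n) (apply_mat n U)"
    by (simp add: distr_distr)
  then show ?thesis
    using 1 by (simp add: gauss_orth_def mult_carrier_mat[of _ n n _ n] gauss_orthD(4)[OF U] gauss_orthD(4)[OF V])
qed

definition givens :: "nat \<Rightarrow> nat \<Rightarrow> nat \<Rightarrow> real \<Rightarrow> real \<Rightarrow> real mat" where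
  "givens n i j c s = Matrix.mat n n (\<lambda>(k, l).
     if k = i then (if l = i then c else 0) + (if l = j then - s else 0)
     else if k = j then (if l = i then s else 0) + (if l = j then c else 0)
     else if l = k then 1 else 0)"

lemma givens_row:
  assumes "i < n" "j < n" "k < n"
  shows "(\<Sum>l<n. givens n i j c s $$ (k, l) * y l) =
    (if k = i then c * y i - s * y j else if k = j then s * y i + c * y j else y k)"
  using assms
  by (auto simp: givens_def distrib_right sum.distrib if_distrib[of "\<lambda>a. a * _"] cong: if_cong)

lemma givens_gauss_orth:
  assumes ij: "i < n" "j < n" "i \<noteq> j" and cs: "c\<^sup>2 + s\<^sup>2 = 1" "s \<noteq> 0"
  shows "givens n i j c s \<in> gauss_orth n"
proof -
  let ?G = "givens n i j c s"
  have G: "?G \<in> carrier_mat n n" by (simp add: givens_def)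
  have "?G * transpose_mat ?G = 1\<^sub>m n"
  proof (rule eq_matI)
    fix k l assume kl: "k < dim_row (1\<^sub>m n)" "l < dim_col (1\<^sub>m n)"
    have "(?G * transpose_mat ?G) $$ (k, l) = (\<Sum>m<n. ?G $$ (k, m) * ?G $$ (l, m))"
      using kl G by (simp add: scalar_prod_def atLeast0LessThan)
    also have "\<dots> = 1\<^sub>m n $$ (k, l)"
      using kl ij cs(1) by (subst givens_row) (auto simp: givens_def power2_eq_square algebra_simps)
    finally show "(?G * transpose_mat ?G) $$ (k, l) = 1\<^sub>m n $$ (k, l)" .
  qed (use G in auto)
  moreover have "distr (gauss_pow n) (gauss_pow n) (apply_mat n ?G) =
      distr (gauss_pow n) (gauss_pow n) (plane_rot i j c s)"
  proof (rule distr_cong)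
    fix x assume "x \<in> space (gauss_pow n)"
    then show "apply_mat n ?G x = plane_rot i j c s x"
      using ij by (intro ext) (auto simp: space_gauss_pow apply_mat_def givens_row plane_rot_def PiE_def extensional_def)
  qed auto
  ultimately show ?thesis
    using G distr_plane_rot[OF ij cs] by (simp add: gauss_orth_def)
qed

text \<open>
  Each nonzero coordinate is moved into the last one by a rotation of the plane that these two span.
  The sine of its angle is nonzero because the coordinate is, as \<open>givens_gauss_orth\<close> demands.
\<close>

lemma rotate_to_last_axis:
  obtains U where "U \<in> gauss_orth (Suc m)" "\<forall>i<m. apply_mat (Suc m) U x i = 0"
proof -
  have "\<exists>U\<in>gauss_orth (Suc m). \<forall>i<k. apply_mat (Suc m) U x i = 0" if "k \<le> m" for k
    using that
  proof (induction k)
    case 0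
    then show ?case using gauss_orth_one by auto
  next
    case (Suc k)
    then obtain U where U: "U \<in> gauss_orth (Suc m)" "\<forall>i<k. apply_mat (Suc m) U x i = 0" by auto
    define w where "w = apply_mat (Suc m) U x"
    show ?case
    proof (cases "w k = 0")
      case True
      then show ?thesis using U by (auto simp: w_def less_Suc_eq)
    next
      case False
      define r where "r = sqrt ((w k)\<^sup>2 + (w m)\<^sup>2)"
      have r: "r > 0" using False by (auto simp: r_def sum_power2_gt_zero_iff)
      define c where "c = w m / r"
      define s where "s = w k / r"
      have "r\<^sup>2 = (w k)\<^sup>2 + (w m)\<^sup>2" by (simp add: r_def)
      then have cs: "c\<^sup>2 + s\<^sup>2 = 1" "s \<noteq> 0"
        using r False by (auto simp: c_def s_def power_divide add_divide_distrib[symmetric])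
      let ?G = "givens (Suc m) k m c s"
      have G: "?G \<in> gauss_orth (Suc m)" using Suc.prems cs by (intro givens_gauss_orth) auto
      have "apply_mat (Suc m) (?G * U) x i = 0" if i: "i < Suc k" for i
      proof -
        have "apply_mat (Suc m) (?G * U) x i = (\<Sum>l<Suc m. ?G $$ (i, l) * w l)"
          using i Suc.prems gauss_orthD(1)[OF U(1)] gauss_orthD(1)[OF G]
          by (subst apply_mat_mult) (auto simp: w_def apply_mat_def simp del: sum.lessThan_Suc)
        also have "\<dots> = (if i = k then c * w k - s * w m else w i)"
          using i Suc.prems by (subst givens_row) auto
        also have "\<dots> = 0" using i U(2) by (auto simp: c_def s_def w_def less_Suc_eq)
        finally show ?thesis .
      qed
      then show ?thesis using gauss_orth_mult[OF G U(1)] by blast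
    qed
  qed
  from this[of m] show thesis using that by blast
qed

lemma mult_block_diag:
  fixes U V E F :: "real mat"
  assumes "U \<in> carrier_mat n n" "V \<in> carrier_mat n n" "E \<in> carrier_mat 1 1" "F \<in> carrier_mat 1 1"
  shows "four_block_mat U (0\<^sub>m n 1) (0\<^sub>m 1 n) E * four_block_mat V (0\<^sub>m n 1) (0\<^sub>m 1 n) F =
    four_block_mat (U * V) (0\<^sub>m n 1) (0\<^sub>m 1 n) (E * F)"
  using assms mult_carrier_mat[OF assms(1,2)] mult_carrier_mat[OF assms(3,4)]
  by (subst mult_four_block_mat[OF assms(1) _ _ assms(3) assms(2) _ _ assms(4)])
    (simp_all del: One_nat_def add: right_mult_zero_mat[of _ n n] left_mult_zero_mat[of _ n n]
      right_mult_zero_mat[of _ 1 1] left_mult_zero_mat[of _ 1 1]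
      right_add_zero_mat[of _ n n] left_add_zero_mat[of _ 1 1])

text \<open>
  This carries the induction of the spectral theorem from size \<open>n\<close> to size \<open>Suc n\<close>: the last
  coordinate is an independent factor of the Gaussian measure.
\<close>

lemma extend_gauss_orth:
  assumes U: "U \<in> gauss_orth n"
  shows "four_block_mat U (0\<^sub>m n 1) (0\<^sub>m 1 n) (1\<^sub>m 1) \<in> gauss_orth (Suc n)" (is "?V \<in> _")
proof -
  note [simp] = gauss_orthD(1)[OF U]
  have V: "?V \<in> carrier_mat (Suc n) (Suc n)" using four_block_carrier_mat[of U n n "1\<^sub>m 1" 1 1] by simp
  have "transpose_mat ?V = four_block_mat (transpose_mat U) (0\<^sub>m n 1) (0\<^sub>m 1 n) (1\<^sub>m 1)"
    by (subst transpose_four_block_mat[of _ n n _ 1 _ 1]) auto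
  then have "?V * transpose_mat ?V = four_block_mat (U * transpose_mat U) (0\<^sub>m n 1) (0\<^sub>m 1 n) (1\<^sub>m 1)"
    by (simp del: One_nat_def add: mult_block_diag)
  also have "\<dots> = 1\<^sub>m (Suc n)"
    by (rule eq_matI) (auto simp: gauss_orthD(2)[OF U])
  finally have VV: "?V * transpose_mat ?V = 1\<^sub>m (Suc n)" .
  have entry: "?V $$ (k, j) = (if k < n then if j < n then U $$ (k, j) else 0 else if j < n then 0 else 1)"
    if "k < Suc n" "j < Suc n" for k j
    using that carrier_matD[OF gauss_orthD(1)[OF U]] by (subst index_mat_four_block) auto
  have app: "apply_mat (Suc n) ?V (x(n := y)) = (apply_mat n U x)(n := y)" for x y
  proof (rule ext)
    fix k
    have "(\<Sum>j<Suc n. ?V $$ (k, j) * (x(n := y)) j) = (if k < n then \<Sum>j<n. U $$ (k, j) * x j else y)"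
      if "k < Suc n"
      using that by (simp add: entry del: One_nat_def)
    then show "apply_mat (Suc n) ?V (x(n := y)) k = ((apply_mat n U x)(n := y)) k"
      unfolding apply_mat_def by (auto simp del: sum.lessThan_Suc)
  qed
  have "distr (gauss_pow (Suc n)) (gauss_pow (Suc n)) (apply_mat (Suc n) ?V) = gauss_pow (Suc n)"
  proof (rule distr_eqI_nn_integral)
    fix f :: "(nat \<Rightarrow> real) \<Rightarrow> ennreal" assume f [measurable]: "f \<in> borel_measurable (gauss_pow (Suc n))"
    define g where "g x = (\<integral>\<^sup>+ y. f (x(n := y)) \<partial>gauss)" for x
    have [measurable]: "g \<in> borel_measurable (gauss_pow n)"
    proof -
      interpret prob_space gauss by (rule prob_space_gauss)
      have [measurable]: "f \<in> borel_measurable (\<Pi>\<^sub>M k\<in>insert n {..<n}. gauss)"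
        using f unfolding gauss_pow_def lessThan_Suc .
      show ?thesis unfolding g_def gauss_pow_def by measurable
    qed
    have "(\<integral>\<^sup>+ x. f (apply_mat (Suc n) ?V x) \<partial>gauss_pow (Suc n)) = (\<integral>\<^sup>+ x. g (apply_mat n U x) \<partial>gauss_pow n)"
      by (subst gauss_pow_Suc) (simp_all add: app g_def del: One_nat_def)
    also have "\<dots> = (\<integral>\<^sup>+ x. g x \<partial>distr (gauss_pow n) (gauss_pow n) (apply_mat n U))"
      by (rule nn_integral_distr[symmetric]) measurable
    also have "\<dots> = (\<integral>\<^sup>+ x. f x \<partial>gauss_pow (Suc n))"
      unfolding gauss_orthD(4)[OF U] g_def by (rule gauss_pow_Suc[OF f, symmetric])
    finally show "(\<integral>\<^sup>+ x. f (apply_mat (Suc n) ?V x) \<partial>gauss_pow (Suc n)) = (\<integral>\<^sup>+ x. f x \<partial>gauss_pow (Suc n))" .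
  qed measurable
  then show ?thesis using V VV by (simp add: gauss_orth_def)
qed

lemma congruence_mult:
  fixes U V A :: "real mat"
  assumes "U \<in> carrier_mat n n" "V \<in> carrier_mat n n" "A \<in> carrier_mat n n"
  shows "U * V * A * transpose_mat (U * V) = U * (V * A * transpose_mat V) * transpose_mat U"
  using assms by (simp add: transpose_mult[of _ n n _ n] assoc_mult_mat[of _ n n _ n _ n]
      mult_carrier_mat[of _ n n _ n])

text \<open>
  Rotating an eigenvector to the last axis splits off its eigenvalue: by symmetry the last row and the
  last column of the rotated matrix vanish off the diagonal. The induction hypothesis diagonalises the
  remaining block.
\<close>

lemma spectral_gauss_orth:
  assumes "A \<in> carrier_mat n n" "transpose_mat A = A"
  obtains U \<mu> where "U \<in> gauss_orth n" "U * A * transpose_mat U = mat_diag n \<mu>"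
proof -
  have "\<exists>U\<in>gauss_orth n. \<exists>\<mu>. U * A * transpose_mat U = mat_diag n \<mu>"
    using assms
  proof (induction n arbitrary: A)
    case 0
    then have "1\<^sub>m 0 * A * transpose_mat (1\<^sub>m 0) = mat_diag 0 (\<lambda>_. 0)"
      by (intro eq_matI) (auto simp: mat_diag_def)
    then show ?case using gauss_orth_one[of 0] by blast
  next
    case (Suc n)
    note A [simp] = Suc.prems(1)
    obtain e x where x: "\<exists>i<Suc n. x i \<noteq> 0" "\<forall>i<Suc n. (\<Sum>j<Suc n. A $$ (i, j) * x j) = e * x i"
      by (rule symmetric_eigenvector[OF Suc.prems zero_less_Suc])
    obtain R where R: "R \<in> gauss_orth (Suc n)" "\<forall>i<n. apply_mat (Suc n) R x i = 0"
      by (rule rotate_to_last_axis)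
    note RD [simp] = gauss_orthD(1)[OF R(1)] and RR = gauss_orthD(3)[OF R(1)]
    define w where "w = apply_mat (Suc n) R x"
    define B where "B = R * A * transpose_mat R"
    have B [simp]: "B \<in> carrier_mat (Suc n) (Suc n)" by (simp add: B_def mult_carrier_mat[of _ "Suc n" "Suc n" _ "Suc n"])
    have Bsym: "transpose_mat B = B"
      by (simp add: B_def transpose_mult[of _ "Suc n" "Suc n" _ "Suc n"] Suc.prems(2)
          assoc_mult_mat[of _ "Suc n" "Suc n" _ "Suc n" _ "Suc n"] mult_carrier_mat[of _ "Suc n" "Suc n" _ "Suc n"])
    have BR: "B * R = R * A"
      by (simp add: B_def assoc_mult_mat[of _ "Suc n" "Suc n" _ "Suc n" _ "Suc n"] mult_carrier_mat[of _ "Suc n" "Suc n" _ "Suc n"] RR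
          right_mult_one_mat[of _ "Suc n" "Suc n"])
    have "w n \<noteq> 0"
    proof
      assume "w n = 0"
      then have w0: "w i = 0" if "i < Suc n" for i using R(2) that by (auto simp: w_def less_Suc_eq)
      have "x i = 0" if i: "i < Suc n" for i
      proof -
        have "x i = apply_mat (Suc n) (transpose_mat R * R) x i" using i by (simp add: RR apply_mat_one)
        also have "\<dots> = apply_mat (Suc n) (transpose_mat R) w i" by (subst apply_mat_mult) (auto simp: w_def)
        also have "\<dots> = 0" using w0 i by (simp add: apply_mat_def)
        finally show ?thesis .
      qed
      then show False using x(1) by blast
    qed
    have Bw: "apply_mat (Suc n) B w k = e * w k" if k: "k < Suc n" for k
    proof -
      have "apply_mat (Suc n) B w = apply_mat (Suc n) R (apply_mat (Suc n) A x)"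
        unfolding w_def by (simp add: apply_mat_mult[symmetric] BR)
      also have "\<dots> = apply_mat (Suc n) R (\<lambda>i. e * x i)"
        using x(2) by (intro apply_mat_cong) (simp add: apply_mat_def)
      finally show ?thesis using k by (simp add: apply_mat_smult w_def)
    qed
    have Bn: "B $$ (k, n) = (if k = n then e else 0)" if k: "k < Suc n" for k
    proof -
      have "(\<Sum>j<n. B $$ (k, j) * w j) = 0" using R(2) by (simp add: w_def)
      then have "B $$ (k, n) * w n = e * w k" using Bw[OF k] k by (simp add: apply_mat_def)
      then show ?thesis using \<open>w n \<noteq> 0\<close> R(2) k by (auto simp: w_def less_Suc_eq)
    qed
    have Bn': "B $$ (n, k) = (if k = n then e else 0)" if k: "k < Suc n" for k
      using Bn[OF k] arg_cong[OF Bsym, of "\<lambda>B. B $$ (n, k)"] k B by auto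
    define B' where "B' = Matrix.mat n n (\<lambda>(i, j). B $$ (i, j))"
    have B' [simp]: "B' \<in> carrier_mat n n" by (simp add: B'_def)
    have "transpose_mat B' = B'"
    proof (rule eq_matI)
      fix i j assume ij: "i < dim_row B'" "j < dim_col B'"
      then have "transpose_mat B $$ (i, j) = B $$ (j, i)" using carrier_matD[OF B] by (simp add: B'_def)
      then show "transpose_mat B' $$ (i, j) = B' $$ (i, j)" using ij Bsym by (simp add: B'_def)
    qed (simp_all add: B'_def)
    from Suc.IH[OF B' this] obtain U \<mu> where U: "U \<in> gauss_orth n"
      "U * B' * transpose_mat U = mat_diag n \<mu>" by blast
    note UD [simp] = gauss_orthD(1)[OF U(1)]
    let ?V = "four_block_mat U (0\<^sub>m n 1) (0\<^sub>m 1 n) (1\<^sub>m 1)"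
    have V: "?V \<in> gauss_orth (Suc n)" by (rule extend_gauss_orth[OF U(1)])
    note VD [simp] = gauss_orthD(1)[OF V]
    let ?E = "mat_diag 1 (\<lambda>_. e)"
    have Bblock: "B = four_block_mat B' (0\<^sub>m n 1) (0\<^sub>m 1 n) ?E"
      using carrier_matD[OF B] Bn Bn' by (intro eq_matI) (auto simp: B'_def mat_diag_def less_Suc_eq)
    have "transpose_mat ?V = four_block_mat (transpose_mat U) (0\<^sub>m n 1) (0\<^sub>m 1 n) (1\<^sub>m 1)"
      by (subst transpose_four_block_mat[of _ n n _ 1 _ 1]) auto
    then have "?V * B * transpose_mat ?V = four_block_mat (U * B' * transpose_mat U) (0\<^sub>m n 1) (0\<^sub>m 1 n) ?E"
      unfolding Bblock by (simp del: One_nat_def add: mult_block_diag mult_carrier_mat[of _ n n _ n]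
          left_mult_one_mat[of _ 1 1] right_mult_one_mat[of _ 1 1])
    also have "\<dots> = mat_diag (Suc n) (\<mu>(n := e))"
      unfolding U(2) by (intro eq_matI) (auto simp: mat_diag_def)
    finally have "?V * R * A * transpose_mat (?V * R) = mat_diag (Suc n) (\<mu>(n := e))"
      unfolding B_def by (subst congruence_mult[OF VD RD A])
    then show ?case using gauss_orth_mult[OF V R(1)] by blast
  qed
  then show thesis using that by blast
qed


section \<open>Diagonalised quadratic forms and centred chi-square sums\<close>

lemma mat_diag_pow: "mat_diag n f ^\<^sub>m r = mat_diag n (\<lambda>i. (f i :: real) ^ r)"
  by (induction r) (simp_all add: carrier_matD[OF mat_diag_dim] mult.commute)

lemma entry_congruence_diag:
  fixes U :: "real mat"
  assumes U: "U \<in> carrier_mat n n" and ij: "i < n" "j < n"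
  shows "(transpose_mat U * mat_diag n f * U) $$ (i, j) = (\<Sum>k<n. U $$ (k, i) * f k * U $$ (k, j))"
  using assms
  by (subst mat_diag_mult_right[of _ n n]) (auto simp: scalar_prod_def atLeast0LessThan)

lemma diagonalised:
  fixes U A :: "real mat"
  assumes U: "U \<in> gauss_orth n" and A: "A \<in> carrier_mat n n"
    and D: "U * A * transpose_mat U = mat_diag n \<mu>"
  shows "(\<Sum>i<n. \<Sum>j<n. A $$ (i, j) * x i * x j) = (\<Sum>k<n. \<mu> k * (apply_mat n U x k)\<^sup>2)"
    and "mat_trace (A ^\<^sub>m r) = (\<Sum>k<n. \<mu> k ^ r)"
proof -
  note Uc [simp] = gauss_orthD(1)[OF U]
  have Ut [simp]: "transpose_mat U \<in> carrier_mat n n" by simp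
  have "A = (transpose_mat U * U) * A * (transpose_mat U * U)"
    using A by (simp add: gauss_orthD(3)[OF U])
  also have "\<dots> = transpose_mat U * (U * A * transpose_mat U) * U"
    using A by (simp add: assoc_mult_mat[of _ n n _ n _ n] mult_carrier_mat[of _ n n _ n])
  finally have AD: "A = transpose_mat U * mat_diag n \<mu> * U" unfolding D .
  then have wit: "similar_mat_wit A (mat_diag n \<mu>) (transpose_mat U) U"
    using A gauss_orthD[OF U] by (intro similar_mat_witI[of _ _ n]) auto
  have "A ^\<^sub>m r = transpose_mat U * mat_diag n (\<lambda>i. \<mu> i ^ r) * U"
    using similar_mat_wit_pow_id[OF wit, of r] by (simp add: mat_diag_pow)
  then have "mat_trace (A ^\<^sub>m r) = (\<Sum>i<n. (transpose_mat U * mat_diag n (\<lambda>i. \<mu> i ^ r) * U) $$ (i, i))"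
    using carrier_matD[OF Uc] by (simp add: mat_trace_def del: index_mult_mat(1))
  also have "\<dots> = (\<Sum>i<n. \<Sum>k<n. U $$ (k, i) * \<mu> k ^ r * U $$ (k, i))"
    by (intro sum.cong refl entry_congruence_diag[OF Uc]) auto
  also have "\<dots> = (\<Sum>k<n. \<mu> k ^ r * (\<Sum>i<n. U $$ (k, i) * U $$ (k, i)))"
    by (subst sum.swap) (simp add: sum_distrib_left mult_ac)
  also have "\<dots> = (\<Sum>k<n. \<mu> k ^ r)"
  proof (rule sum.cong)
    fix k assume k: "k \<in> {..<n}"
    have "(U * transpose_mat U) $$ (k, k) = (\<Sum>i<n. U $$ (k, i) * U $$ (k, i))"
      using k carrier_matD[OF Uc] by (simp add: scalar_prod_def atLeast0LessThan)
    then show "\<mu> k ^ r * (\<Sum>i<n. U $$ (k, i) * U $$ (k, i)) = \<mu> k ^ r"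
      using k by (simp add: gauss_orthD(2)[OF U])
  qed simp
  finally show "mat_trace (A ^\<^sub>m r) = (\<Sum>k<n. \<mu> k ^ r)" .
  have "(\<Sum>i<n. \<Sum>j<n. A $$ (i, j) * x i * x j) =
      (\<Sum>i<n. \<Sum>j<n. \<Sum>k<n. \<mu> k * ((U $$ (k, i) * x i) * (U $$ (k, j) * x j)))"
  proof (intro sum.cong refl)
    fix i j assume "i \<in> {..<n}" "j \<in> {..<n}"
    then have "A $$ (i, j) = (\<Sum>k<n. U $$ (k, i) * \<mu> k * U $$ (k, j))"
      by (subst AD) (simp only: entry_congruence_diag[OF Uc] lessThan_iff)
    then show "A $$ (i, j) * x i * x j = (\<Sum>k<n. \<mu> k * ((U $$ (k, i) * x i) * (U $$ (k, j) * x j)))"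
      by (simp add: sum_distrib_left mult_ac)
  qed
  also have "\<dots> = (\<Sum>k<n. \<Sum>i<n. \<Sum>j<n. \<mu> k * ((U $$ (k, i) * x i) * (U $$ (k, j) * x j)))"
    by (subst sum.swap[of _ _ "{..<n}"], subst (2) sum.swap, rule refl)
  also have "\<dots> = (\<Sum>k<n. \<mu> k * (apply_mat n U x k)\<^sup>2)"
    unfolding power2_eq_square apply_mat_def
    by (intro sum.cong refl) (simp only: restrict_apply' sum_product, simp only: sum_distrib_left)
  finally show "(\<Sum>i<n. \<Sum>j<n. A $$ (i, j) * x i * x j) = (\<Sum>k<n. \<mu> k * (apply_mat n U x k)\<^sup>2)" .
qed

lemma sum_squares_eq_trace:
  assumes A: "A \<in> carrier_mat n n" and sym: "transpose_mat A = A"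
  shows "sum_squares A = mat_trace (A ^\<^sub>m 2)"
proof -
  have "A ^\<^sub>m 2 = A * A" using A by (simp add: numeral_2_eq_2)
  then show ?thesis
    using A by (auto simp: sum_squares_def mat_trace_def scalar_prod_def atLeast0LessThan
        power2_eq_square symmetric_entry[OF A sym] intro!: sum.cong)
qed

lemma prob_space_gauss_pow: "prob_space (gauss_pow n)"
  unfolding gauss_pow_def by (intro prob_space_PiM prob_space_gauss)

lemma measurable_gauss_pow_component:
  "k < n \<Longrightarrow> (\<lambda>w. w k) \<in> borel_measurable (gauss_pow n)"
  unfolding gauss_pow_def by measurable

lemma distr_gauss_pow_reindex:
  assumes "inj_on t {..<q}" "t ` {..<q} \<subseteq> {..<n}"
  shows "distr (gauss_pow n) (gauss_pow q) (\<lambda>w. \<lambda>m\<in>{..<q}. w (t m)) = gauss_pow q"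
  unfolding gauss_pow_def
  by (rule distr_PiM_reindex) (use assms prob_space_gauss in auto)

lemma iid_distr_gauss_pow:
  assumes iid: "iid_std_normal M Z" and n: "n > 0"
  shows "(\<lambda>\<omega>. \<lambda>i\<in>{..<n}. Z i \<omega>) \<in> measurable M (gauss_pow n)"
    and "distr M (gauss_pow n) (\<lambda>\<omega>. \<lambda>i\<in>{..<n}. Z i \<omega>) = gauss_pow n"
proof -
  interpret prob_space M using iid by (simp add: iid_std_normal_def)
  have Z: "distributed M lborel (Z i) std_normal_density" for i using iid by (simp add: iid_std_normal_def)
  have rv [measurable]: "Z i \<in> borel_measurable M" for i
    using distributed_measurable[OF Z[of i]] by simp
  have g: "distr M borel (Z i) = gauss" for i
    using distributed_distr_eq_density[OF Z[of i]] by (simp add: gauss_def cong: distr_cong)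
  have "(\<lambda>\<omega>. \<lambda>i\<in>{..<n}. Z i \<omega>) \<in> measurable M (\<Pi>\<^sub>M i\<in>{..<n}. borel)" by measurable
  then show "(\<lambda>\<omega>. \<lambda>i\<in>{..<n}. Z i \<omega>) \<in> measurable M (gauss_pow n)"
    by (simp cong: measurable_cong_sets add: sets_gauss_pow)
  have "indep_vars (\<lambda>_. borel) Z {..<n}"
    by (rule indep_vars_subset[of _ _ UNIV]) (use iid in \<open>auto simp: iid_std_normal_def\<close>)
  then have "distr M (\<Pi>\<^sub>M i\<in>{..<n}. borel) (\<lambda>\<omega>. \<lambda>i\<in>{..<n}. Z i \<omega>) = gauss_pow n"
    using n by (subst (asm) indep_vars_iff_distr_eq_PiM') (auto simp: g gauss_pow_def)
  then show "distr M (gauss_pow n) (\<lambda>\<omega>. \<lambda>i\<in>{..<n}. Z i \<omega>) = gauss_pow n"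
    by (simp add: sets_gauss_pow cong: distr_cong)
qed

definition centred_chi :: "nat \<Rightarrow> (nat \<Rightarrow> real) \<Rightarrow> (nat \<Rightarrow> real) \<Rightarrow> real" where
  "centred_chi n c w = (\<Sum>k<n. c k * ((w k)\<^sup>2 - 1))"

lemma measurable_chi [measurable]: "centred_chi n c \<in> borel_measurable (gauss_pow n)"
  unfolding centred_chi_def
  by (intro borel_measurable_sum borel_measurable_times borel_measurable_diff borel_measurable_power
      borel_measurable_const measurable_gauss_pow_component) simp

text \<open>
  This uses the moments \<open>1\<close>, \<open>1\<close> and \<open>3\<close> of order \<open>0\<close>, \<open>2\<close> and \<open>4\<close> of the normal law. The free summand \<open>S\<close>
  is the part that depends on the other coordinates when \<open>chi_second_moment\<close> integrates them out one
  at a time.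
\<close>

lemma gauss_second_moment:
  "(\<integral>\<^sup>+ y. ennreal ((S + c * (y\<^sup>2 - 1))\<^sup>2) \<partial>gauss) = ennreal (S\<^sup>2 + 2 * c\<^sup>2)"
proof -
  let ?d = "std_normal_density"
  have "has_bochner_integral lborel (\<lambda>y. (S - c)\<^sup>2 * (?d y * y ^ (2 * 0)) + 2 * (S - c) * c * (?d y * y ^ (2 * 1))
      + c\<^sup>2 * (?d y * y ^ (2 * 2)))
    ((S - c)\<^sup>2 * (fact (2 * 0) / (2 ^ 0 * fact 0)) + 2 * (S - c) * c * (fact (2 * 1) / (2 ^ 1 * fact 1))
      + c\<^sup>2 * (fact (2 * 2) / (2 ^ 2 * fact 2)))"
    by (intro has_bochner_integral_add has_bochner_integral_mult_right std_normal_moment_even)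
  also have "(\<lambda>y. (S - c)\<^sup>2 * (?d y * y ^ (2 * 0)) + 2 * (S - c) * c * (?d y * y ^ (2 * 1))
      + c\<^sup>2 * (?d y * y ^ (2 * 2))) = (\<lambda>y. ?d y * (S + c * (y\<^sup>2 - 1))\<^sup>2)"
    by (rule ext) (simp add: algebra_simps power2_eq_square power4_eq_xxxx)
  also have "(S - c)\<^sup>2 * (fact (2 * 0) / (2 ^ 0 * fact 0)) + 2 * (S - c) * c * (fact (2 * 1) / (2 ^ 1 * fact 1))
      + c\<^sup>2 * (fact (2 * 2) / (2 ^ 2 * fact 2)) = S\<^sup>2 + 2 * c\<^sup>2"
    by (simp add: fact_numeral algebra_simps power2_eq_square)
  finally have b: "has_bochner_integral lborel (\<lambda>y. ?d y * (S + c * (y\<^sup>2 - 1))\<^sup>2) (S\<^sup>2 + 2 * c\<^sup>2)" .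
  have "(\<integral>\<^sup>+ y. ennreal ((S + c * (y\<^sup>2 - 1))\<^sup>2) \<partial>gauss) =
      (\<integral>\<^sup>+ y. ennreal (?d y * (S + c * (y\<^sup>2 - 1))\<^sup>2) \<partial>lborel)"
    unfolding gauss_def by (subst nn_integral_density) (auto simp: ennreal_mult)
  also have "\<dots> = ennreal (S\<^sup>2 + 2 * c\<^sup>2)"
    using b by (subst nn_integral_eq_integral) (auto simp: has_bochner_integral_iff)
  finally show ?thesis .
qed

lemma chi_second_moment:
  "(\<integral>\<^sup>+ w. ennreal ((centred_chi n c w)\<^sup>2) \<partial>gauss_pow n) = ennreal (2 * (\<Sum>k<n. (c k)\<^sup>2))"
proof (induction n)
  case 0
  then show ?case by (simp add: centred_chi_def)
next
  case (Suc n)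
  interpret prob_space "gauss_pow n" by (rule prob_space_gauss_pow)
  have "centred_chi (Suc n) c (w(n := y)) = centred_chi n c w + c n * (y\<^sup>2 - 1)" for w y
    by (simp add: centred_chi_def)
  then have "(\<integral>\<^sup>+ w. ennreal ((centred_chi (Suc n) c w)\<^sup>2) \<partial>gauss_pow (Suc n)) =
      (\<integral>\<^sup>+ w. ennreal ((centred_chi n c w)\<^sup>2) + ennreal (2 * (c n)\<^sup>2) \<partial>gauss_pow n)"
    by (subst gauss_pow_Suc) (simp_all add: gauss_second_moment)
  also have "\<dots> = (\<integral>\<^sup>+ w. ennreal ((centred_chi n c w)\<^sup>2) \<partial>gauss_pow n) + ennreal (2 * (c n)\<^sup>2)"
    by (subst nn_integral_add) (auto simp: emeasure_space_1)
  also have "\<dots> = ennreal (2 * (\<Sum>k<n. (c k)\<^sup>2) + 2 * (c n)\<^sup>2)"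
    unfolding Suc by (rule ennreal_plus[symmetric]) (auto intro: sum_nonneg)
  finally show ?case by (simp add: distrib_left)
qed

lemma gauss_square: "integrable gauss (\<lambda>y. y\<^sup>2)" "(\<integral>y. y\<^sup>2 \<partial>gauss) = 1"
proof -
  have "has_bochner_integral lborel (\<lambda>y. std_normal_density y * y\<^sup>2) 1"
    using std_normal_moment_even[of 1] by simp
  then show "integrable gauss (\<lambda>y. y\<^sup>2)" "(\<integral>y. y\<^sup>2 \<partial>gauss) = 1"
    by (auto simp: gauss_def integrable_density integral_density has_bochner_integral_iff)
qed

lemma gauss_pow_component_square:
  assumes "k < n"
  shows "integrable (gauss_pow n) (\<lambda>w. (w k)\<^sup>2)" "(\<integral>w. (w k)\<^sup>2 \<partial>gauss_pow n) = 1"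
proof -
  have d: "distr (gauss_pow n) gauss (\<lambda>w. w k) = gauss"
    unfolding gauss_pow_def by (rule distr_PiM_component) (use assms prob_space_gauss in auto)
  have m: "(\<lambda>w. w k) \<in> measurable (gauss_pow n) gauss"
    unfolding gauss_pow_def by (rule measurable_component_singleton) (use assms in simp)
  have "integrable (distr (gauss_pow n) gauss (\<lambda>w. w k)) (\<lambda>y. y\<^sup>2)" "(\<integral>y. y\<^sup>2 \<partial>distr (gauss_pow n) gauss (\<lambda>w. w k)) = 1"
    unfolding d by (fact gauss_square)+
  then show "integrable (gauss_pow n) (\<lambda>w. (w k)\<^sup>2)" "(\<integral>w. (w k)\<^sup>2 \<partial>gauss_pow n) = 1"
    using integrable_distr_eq[OF m, of "\<lambda>y. y\<^sup>2"] integral_distr[OF m, of "\<lambda>y. y\<^sup>2"] by auto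
qed

text \<open>
  The integrand is a multiple of a normal density of variance \<open>1 / (1 - 2 * a)\<close>.
\<close>

lemma gauss_exp_square:
  assumes "2 * a < 1"
  shows "(\<integral>\<^sup>+ y. ennreal (exp (a * (y\<^sup>2 - 1))) \<partial>gauss) = ennreal (exp (- a) / sqrt (1 - 2 * a))"
proof -
  define \<sigma> where "\<sigma> = 1 / sqrt (1 - 2 * a)"
  have \<sigma>: "\<sigma> > 0" "\<sigma>\<^sup>2 = 1 / (1 - 2 * a)" using assms by (auto simp: \<sigma>_def power_divide)
  have e: "std_normal_density y * exp (a * (y\<^sup>2 - 1)) = exp (- a) * \<sigma> * normal_density 0 \<sigma> y" for y
  proof -
    have "- y\<^sup>2 / 2 + a * (y\<^sup>2 - 1) = - a + - y\<^sup>2 / (2 * \<sigma>\<^sup>2)"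
      unfolding \<sigma>(2) using assms by (simp add: field_simps)
    then have "exp (- y\<^sup>2 / 2) * exp (a * (y\<^sup>2 - 1)) = exp (- a) * exp (- y\<^sup>2 / (2 * \<sigma>\<^sup>2))"
      by (simp only: exp_add[symmetric])
    then show ?thesis
      using \<sigma>(1) by (simp add: std_normal_density_def normal_density_def real_sqrt_mult field_simps)
  qed
  interpret N: prob_space "density lborel (normal_density 0 \<sigma>)"
    using \<sigma>(1) by (rule prob_space_normal_density)
  have one: "(\<integral>\<^sup>+ y. ennreal (normal_density 0 \<sigma> y) \<partial>lborel) = 1"
    using N.emeasure_space_1 by (simp add: emeasure_density)
  have "(\<integral>\<^sup>+ y. ennreal (exp (a * (y\<^sup>2 - 1))) \<partial>gauss) =
      (\<integral>\<^sup>+ y. ennreal (exp (- a) * \<sigma>) * ennreal (normal_density 0 \<sigma> y) \<partial>lborel)"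
    unfolding gauss_def using \<sigma>(1)
    by (subst nn_integral_density) (auto simp: ennreal_mult[symmetric] e)
  also have "\<dots> = ennreal (exp (- a) * \<sigma>)" by (simp add: nn_integral_cmult one)
  finally show ?thesis by (simp add: \<sigma>_def)
qed

lemma chi_mgf:
  assumes "\<And>k. k < n \<Longrightarrow> 2 * (s * c k) < 1"
  shows "(\<integral>\<^sup>+ w. ennreal (exp (s * centred_chi n c w)) \<partial>gauss_pow n) =
    ennreal (\<Prod>k<n. exp (- (s * c k)) / sqrt (1 - 2 * (s * c k)))"
proof -
  have "exp (s * centred_chi n c w) = (\<Prod>k<n. exp (s * c k * ((w k)\<^sup>2 - 1)))" for w
    by (simp add: centred_chi_def exp_sum sum_distrib_left mult.assoc)
  then have "(\<integral>\<^sup>+ w. ennreal (exp (s * centred_chi n c w)) \<partial>gauss_pow n) =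
      (\<integral>\<^sup>+ w. (\<Prod>k<n. ennreal (exp (s * c k * ((w k)\<^sup>2 - 1)))) \<partial>gauss_pow n)"
    by (simp add: prod_ennreal)
  also have "\<dots> = (\<Prod>k<n. \<integral>\<^sup>+ y. ennreal (exp (s * c k * (y\<^sup>2 - 1))) \<partial>gauss)"
    unfolding gauss_pow_def by (rule gauss.product_nn_integral_prod) auto
  also have "\<dots> = (\<Prod>k<n. ennreal (exp (- (s * c k)) / sqrt (1 - 2 * (s * c k))))"
    using assms by (intro prod.cong gauss_exp_square) auto
  also have "\<dots> = ennreal (\<Prod>k<n. exp (- (s * c k)) / sqrt (1 - 2 * (s * c k)))"
    using assms by (intro prod_ennreal) (auto intro!: divide_nonneg_nonneg simp: less_imp_le)
  finally show ?thesis .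
qed

section \<open>The law determines its coefficients\<close>

lemma poly_eqI_interval:
  fixes p r :: "real poly"
  assumes "\<And>s. \<bar>s\<bar> < d \<Longrightarrow> poly p s = poly r s" "d > 0"
  shows "p = r"
proof (rule ccontr)
  assume "p \<noteq> r"
  then have "finite {s. poly (p - r) s = 0}" by (intro poly_roots_finite) simp
  moreover have "{- d<..<d} \<subseteq> {s. poly (p - r) s = 0}" using assms(1) by auto
  ultimately have "finite {- d<..<d}" by (rule finite_subset[rotated])
  then show False using assms(2) infinite_Ioo[of "- d" d] by simp
qed

text \<open>
  Differentiating and eliminating the exponential gives \<open>r * (a p + p') = p * r'\<close>. For \<open>a \<noteq> 0\<close> the left
  side has degree \<open>degree r + degree p\<close>, which the right side does not reach.
\<close>

lemma exp_times_poly_eq_poly: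
  fixes p r :: "real poly"
  assumes eq: "\<And>s. \<bar>s\<bar> < d \<Longrightarrow> exp (a * s) * poly p s = poly r s" and d: "d > 0" and r0: "r \<noteq> 0"
  shows "a = 0"
proof (rule ccontr)
  assume a: "a \<noteq> 0"
  have p0: "p \<noteq> 0"
  proof
    assume "p = 0"
    then have "r = 0" using eq d by (intro poly_eqI_interval[of d]) auto
    with r0 show False ..
  qed
  have "poly (r * (Polynomial.smult a p + pderiv p)) s = poly (p * pderiv r) s" if s: "\<bar>s\<bar> < d" for s
  proof -
    have "((\<lambda>s. exp (a * s) * poly p s) has_real_derivative
        (exp (a * s) * (a * poly p s + poly (pderiv p) s))) (at s)"
      by (auto intro!: derivative_eq_intros simp: algebra_simps)
    moreover have "((\<lambda>s. exp (a * s) * poly p s) has_real_derivative poly (pderiv r) s) (at s)"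
    proof (rule has_field_derivative_transform_within_open)
      show "(poly r has_real_derivative poly (pderiv r) s) (at s)" by (rule poly_DERIV)
      show "open {- d<..<d}" "s \<in> {- d<..<d}" using s by auto
    qed (use eq in auto)
    ultimately have "exp (a * s) * (a * poly p s + poly (pderiv p) s) = poly (pderiv r) s"
      by (rule DERIV_unique)
    then have "poly p s * poly (pderiv r) s = poly p s * (exp (a * s) * (a * poly p s + poly (pderiv p) s))"
      by simp
    also have "\<dots> = poly (r * (Polynomial.smult a p + pderiv p)) s"
      by (simp add: eq[OF s, symmetric] algebra_simps)
    finally show ?thesis by simp
  qed
  then have e: "r * (Polynomial.smult a p + pderiv p) = p * pderiv r" by (rule poly_eqI_interval) (use d in auto)
  show False
  proof (cases "degree r = 0")
    case True
    then have "pderiv r = 0" by (simp add: pderiv_eq_0_iff)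
    then have z: "Polynomial.smult a p + pderiv p = 0" using e r0 by simp
    then have "coeff (Polynomial.smult a p + pderiv p) (degree p) = 0" by simp
    then show False using a p0 by (simp add: coeff_pderiv coeff_eq_0)
  next
    case False
    have "coeff (Polynomial.smult a p + pderiv p) (degree p) = a * lead_coeff p"
      by (simp add: coeff_pderiv coeff_eq_0)
    then have n0: "coeff (Polynomial.smult a p + pderiv p) (degree p) \<noteq> 0" using a p0 by simp
    then have "degree p \<le> degree (Polynomial.smult a p + pderiv p)" by (rule le_degree)
    moreover have "Polynomial.smult a p + pderiv p \<noteq> 0" using n0 by (metis coeff_0)
    ultimately have "degree r + degree p \<le> degree (r * (Polynomial.smult a p + pderiv p))"
      using r0 by (simp add: degree_mult_eq)
    also have "\<dots> \<le> degree p + degree (pderiv r)" unfolding e by (rule degree_mult_le)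
    finally show False using False by (simp add: degree_pderiv)
  qed
qed

text \<open>
  The exponential moments of a centred chi-square sum with coefficient set \<open>\<Lambda>\<close>. They link a law to \<open>\<Lambda>\<close>
  without mentioning random variables. The normalisation of \<open>\<Lambda>\<close> makes them finite for \<open>\<bar>s\<bar> < 1 / 2\<close>.
\<close>

definition chi_mgf_on :: "real measure \<Rightarrow> real set \<Rightarrow> bool" where
  "chi_mgf_on L \<Lambda> \<longleftrightarrow> finite \<Lambda> \<and> 0 \<notin> \<Lambda> \<and> (\<Sum>x\<in>\<Lambda>. x\<^sup>2) = 1 \<and>
     (\<forall>s. \<bar>s\<bar> < 1 / 2 \<longrightarrow> (\<integral>\<^sup>+ y. ennreal (exp (s * y)) \<partial>L) = ennreal (\<Prod>x\<in>\<Lambda>. exp (- (s * x)) / sqrt (1 - 2 * (s * x))))"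

lemma chi_mgf_onD:
  assumes "chi_mgf_on L \<Lambda>" "\<bar>s\<bar> < 1 / 2"
  shows "(\<integral>\<^sup>+ y. ennreal (exp (s * y)) \<partial>L) = ennreal (\<Prod>x\<in>\<Lambda>. exp (- (s * x)) / sqrt (1 - 2 * (s * x)))"
  using assms unfolding chi_mgf_on_def by blast

lemma unit_sum_squares_bound:
  fixes \<Lambda> :: "real set"
  assumes "finite \<Lambda>" "(\<Sum>x\<in>\<Lambda>. x\<^sup>2) = 1" "x \<in> \<Lambda>" "\<bar>s\<bar> < 1 / 2"
  shows "2 * (s * x) < 1"
proof -
  have "x\<^sup>2 \<le> (\<Sum>x\<in>\<Lambda>. x\<^sup>2)" using assms by (intro member_le_sum) auto
  then have "\<bar>x\<bar> \<le> 1" using assms by (simp add: abs_square_le_1)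
  then have "\<bar>s\<bar> * \<bar>x\<bar> \<le> \<bar>s\<bar> * 1" by (intro mult_left_mono) auto
  then have "\<bar>s * x\<bar> < 1 / 2" using assms(4) by (simp add: abs_mult)
  then show ?thesis by linarith
qed

text \<open>
  The exponential moment to the power \<open>-2\<close> is \<open>exp (2 * s * \<Sum>\<Lambda>)\<close> times the polynomial
  \<open>\<Prod>x\<in>\<Lambda>. 1 - 2 * s * x\<close>. Hence the sum of \<open>\<Lambda>\<close> and that polynomial are determined by the law, and the
  zeros of the polynomial recover \<open>\<Lambda>\<close>.
\<close>

lemma chi_mgf_on_unique:
  assumes "chi_mgf_on L \<Lambda>" "chi_mgf_on L \<Lambda>'"
  shows "\<Lambda> = \<Lambda>'"
proof -
  define P where "P \<Lambda> = (\<Prod>x\<in>\<Lambda>. [:1, - 2 * x:])" for \<Lambda> :: "real set"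
  define t where "t \<Lambda> = 2 * (\<Sum>x\<in>\<Lambda>. x)" for \<Lambda> :: "real set"
  have P: "poly (P \<Lambda>) s = (\<Prod>x\<in>\<Lambda>. 1 - 2 * (s * x))" for \<Lambda> s
    by (simp add: P_def poly_prod mult_ac)
  have inv_square: "exp (t \<Lambda> * s) * poly (P \<Lambda>) s = 1 / (\<Prod>x\<in>\<Lambda>. exp (- (s * x)) / sqrt (1 - 2 * (s * x)))\<^sup>2"
    and pos: "(\<Prod>x\<in>\<Lambda>. exp (- (s * x)) / sqrt (1 - 2 * (s * x))) > 0"
    if c: "chi_mgf_on L \<Lambda>" and s: "\<bar>s\<bar> < 1 / 2" for s \<Lambda>
  proof -
    have b: "2 * (s * x) < 1" if "x \<in> \<Lambda>" for x
      using unit_sum_squares_bound[OF _ _ that s] c by (auto simp: chi_mgf_on_def)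
    show "(\<Prod>x\<in>\<Lambda>. exp (- (s * x)) / sqrt (1 - 2 * (s * x))) > 0"
      using b by (intro prod_pos) auto
    have "1 / (\<Prod>x\<in>\<Lambda>. exp (- (s * x)) / sqrt (1 - 2 * (s * x)))\<^sup>2 =
        (\<Prod>x\<in>\<Lambda>. 1 / (exp (- (s * x)) / sqrt (1 - 2 * (s * x)))\<^sup>2)"
      unfolding inverse_eq_divide[symmetric] by (subst prod_power_distrib) (rule prod_inversef[symmetric, unfolded o_def])
    also have "\<dots> = (\<Prod>x\<in>\<Lambda>. exp (2 * (s * x)) * (1 - 2 * (s * x)))"
    proof (rule prod.cong)
      fix x assume x: "x \<in> \<Lambda>"
      have "exp (2 * (s * x)) * (exp (- (s * x)))\<^sup>2 = 1"
        by (simp add: power2_eq_square flip: exp_add)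
      moreover have "(sqrt (1 - 2 * (s * x)))\<^sup>2 = 1 - 2 * (s * x)" using b[OF x] by simp
      ultimately show "1 / (exp (- (s * x)) / sqrt (1 - 2 * (s * x)))\<^sup>2 = exp (2 * (s * x)) * (1 - 2 * (s * x))"
        by (simp add: power_divide field_simps)
    qed simp
    also have "\<dots> = (\<Prod>x\<in>\<Lambda>. exp (2 * (s * x))) * poly (P \<Lambda>) s"
      by (simp add: prod.distrib P)
    also have "(\<Prod>x\<in>\<Lambda>. exp (2 * (s * x))) = exp (t \<Lambda> * s)"
      using c by (simp add: t_def exp_sum[symmetric] chi_mgf_on_def sum_distrib_left sum_distrib_right mult_ac)
    finally show "exp (t \<Lambda> * s) * poly (P \<Lambda>) s = 1 / (\<Prod>x\<in>\<Lambda>. exp (- (s * x)) / sqrt (1 - 2 * (s * x)))\<^sup>2"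
      by simp
  qed
  have P0: "P \<Lambda> \<noteq> 0" if "finite \<Lambda>" for \<Lambda> using that by (simp add: P_def)
  have fin: "finite \<Lambda>" "finite \<Lambda>'" "0 \<notin> \<Lambda>" "0 \<notin> \<Lambda>'" using assms by (auto simp: chi_mgf_on_def)
  have eq: "exp (t \<Lambda> * s) * poly (P \<Lambda>) s = exp (t \<Lambda>' * s) * poly (P \<Lambda>') s" if s: "\<bar>s\<bar> < 1 / 2" for s
  proof -
    have "ennreal (\<Prod>x\<in>\<Lambda>. exp (- (s * x)) / sqrt (1 - 2 * (s * x))) =
        ennreal (\<Prod>x\<in>\<Lambda>'. exp (- (s * x)) / sqrt (1 - 2 * (s * x)))"
      using chi_mgf_onD[OF assms(1) s] chi_mgf_onD[OF assms(2) s] by (rule trans[OF sym])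
    then show ?thesis
      using pos[OF assms(1) s] pos[OF assms(2) s]
      by (simp add: inv_square[OF assms(1) s] inv_square[OF assms(2) s])
  qed
  have eq': "exp ((t \<Lambda> - t \<Lambda>') * s) * poly (P \<Lambda>) s = poly (P \<Lambda>') s" if s: "\<bar>s\<bar> < 1 / 2" for s
    using eq[OF s] by (simp add: left_diff_distrib exp_diff field_simps)
  have "t \<Lambda> - t \<Lambda>' = 0"
    by (rule exp_times_poly_eq_poly[of "1 / 2", OF eq']) (use P0 fin in auto)
  then have "P \<Lambda> = P \<Lambda>'"
    using eq' by (intro poly_eqI_interval[of "1 / 2"]) auto
  then have roots: "poly (P \<Lambda>) s = 0 \<longleftrightarrow> poly (P \<Lambda>') s = 0" for s by simp
  have root_iff: "x \<in> \<Lambda> \<longleftrightarrow> poly (P \<Lambda>) (1 / (2 * x)) = 0" if "finite \<Lambda>" "0 \<notin> \<Lambda>" "x \<noteq> 0" for x \<Lambda>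
    using that by (auto simp: P field_simps)
  show ?thesis
  proof (rule Set.set_eqI)
    fix x
    show "x \<in> \<Lambda> \<longleftrightarrow> x \<in> \<Lambda>'"
      using fin roots root_iff[of \<Lambda> x] root_iff[of \<Lambda>' x] by (cases "x = 0") auto
  qed
qed


section \<open>Couplings\<close>

lemma W2_distr_le:
  assumes "prob_space N" and [measurable]: "f \<in> borel_measurable N" "g \<in> borel_measurable N"
    and cost: "(\<integral>\<^sup>+ w. ennreal ((f w - g w)\<^sup>2) \<partial>N) \<le> ennreal (c\<^sup>2)" and c: "c \<ge> 0"
  shows "W2 (distr N borel f) (distr N borel g) \<le> ennreal c"
proof -
  let ?P = "distr N (borel \<Otimes>\<^sub>M borel) (\<lambda>w. (f w, g w))"
  let ?I = "INF P \<in> couplings (distr N borel f) (distr N borel g). \<integral>\<^sup>+ (x, y). ennreal (\<bar>x - y\<bar>\<^sup>2) \<partial>P"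
  have "prob_space ?P" by (rule prob_space.prob_space_distr[OF assms(1)]) measurable
  moreover have "distr ?P borel fst = distr N borel f" "distr ?P borel snd = distr N borel g"
    by (simp_all add: distr_distr o_def)
  ultimately have "?P \<in> couplings (distr N borel f) (distr N borel g)"
    by (simp add: couplings_def)
  then have "?I \<le> (\<integral>\<^sup>+ (x, y). ennreal (\<bar>x - y\<bar>\<^sup>2) \<partial>?P)" by (rule INF_lower)
  also have "\<dots> = (\<integral>\<^sup>+ w. ennreal ((f w - g w)\<^sup>2) \<partial>N)" by (subst nn_integral_distr) simp_all
  finally have I: "?I \<le> ennreal (c\<^sup>2)" using cost by (rule order_trans)
  then have "enn2real ?I \<le> c\<^sup>2" using enn2real_mono[OF I] by simp
  then have "sqrt (enn2real ?I) \<le> c" using c by (intro real_le_lsqrt) auto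
  moreover have "?I < \<top>" using I ennreal_less_top by (rule order_le_less_trans)
  then have "?I \<noteq> \<infinity>" by (simp only: less_top infinity_ennreal_def not_False_eq_True)
  ultimately show ?thesis unfolding W2_def ennreal_sqrt_def by (simp only: if_False ennreal_leI)
qed

text \<open>
  A sum formed from any selection of distinct coordinates has the same law. All couplings below are
  obtained by selecting coordinates of one Gaussian vector.
\<close>

lemma distr_chi_reindex:
  assumes "inj_on t {..<q}" "t ` {..<q} \<subseteq> {..<n}"
  shows "(\<lambda>w. centred_chi q c (\<lambda>m\<in>{..<q}. w (t m))) \<in> borel_measurable (gauss_pow n)"
    and "distr (gauss_pow n) borel (\<lambda>w. centred_chi q c (\<lambda>m\<in>{..<q}. w (t m))) = distr (gauss_pow q) borel (centred_chi q c)"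
proof -
  have "(\<lambda>w. \<lambda>m\<in>{..<q}. w (t m)) \<in> measurable (gauss_pow n) (gauss_pow q)"
    unfolding gauss_pow_def
    by (rule measurable_restrict) (rule measurable_component_singleton, use assms in auto)
  note m [measurable] = this
  show "(\<lambda>w. centred_chi q c (\<lambda>m\<in>{..<q}. w (t m))) \<in> borel_measurable (gauss_pow n)" by measurable
  have "distr (gauss_pow n) borel (centred_chi q c \<circ> (\<lambda>w. \<lambda>m\<in>{..<q}. w (t m))) =
      distr (distr (gauss_pow n) (gauss_pow q) (\<lambda>w. \<lambda>m\<in>{..<q}. w (t m))) borel (centred_chi q c)"
    by (rule distr_distr[symmetric]) measurable
  then show "distr (gauss_pow n) borel (\<lambda>w. centred_chi q c (\<lambda>m\<in>{..<q}. w (t m))) = distr (gauss_pow q) borel (centred_chi q c)"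
    unfolding distr_gauss_pow_reindex[OF assms] by (simp add: o_def)
qed

lemma sum_lessThan_add: "(\<Sum>k<n + q. f k) = (\<Sum>k<n. f k) + (\<Sum>m<q. f (n + m))" for f :: "nat \<Rightarrow> real"
  by (induction q) (simp_all add: add.assoc)

text \<open>
  Disjoint blocks of coordinates give independent sums. The squared distance has expectation
  \<open>2 * (1 + 1)\<close>.
\<close>

lemma W2_chi_trivial:
  assumes "(\<Sum>k<n. (\<mu> k)\<^sup>2) = 1" "(\<Sum>m<q. (l m)\<^sup>2) = 1"
  shows "W2 (distr (gauss_pow n) borel (centred_chi n \<mu>)) (distr (gauss_pow q) borel (centred_chi q l)) \<le> ennreal 2"
proof -
  let ?f = "\<lambda>w. centred_chi n \<mu> (\<lambda>m\<in>{..<n}. w m)" and ?g = "\<lambda>w. centred_chi q l (\<lambda>m\<in>{..<q}. w (n + m))"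
  define c where "c k = (if k < n then \<mu> k else - l (k - n))" for k
  have c2: "(\<Sum>k<n + q. (c k)\<^sup>2) = 2" using assms by (simp add: sum_lessThan_add c_def)
  have "?f w - ?g w = centred_chi (n + q) c w" for w
    by (simp add: centred_chi_def sum_lessThan_add c_def sum_negf)
  then have cost: "(\<integral>\<^sup>+ w. ennreal ((?f w - ?g w)\<^sup>2) \<partial>gauss_pow (n + q)) \<le> ennreal (2\<^sup>2)"
    by (simp add: chi_second_moment c2)
  have f: "?f \<in> borel_measurable (gauss_pow (n + q))"
      "distr (gauss_pow (n + q)) borel ?f = distr (gauss_pow n) borel (centred_chi n \<mu>)"
    by (rule distr_chi_reindex; auto)+
  have g: "?g \<in> borel_measurable (gauss_pow (n + q))"
      "distr (gauss_pow (n + q)) borel ?g = distr (gauss_pow q) borel (centred_chi q l)"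
    by (rule distr_chi_reindex; auto)+
  show ?thesis
    using W2_distr_le[OF prob_space_gauss_pow f(1) g(1) cost] unfolding f(2) g(2) by simp
qed

text \<open>
  The two sums share the squared Gaussian variables that \<open>\<sigma>\<close> pairs, so their difference is again a
  centred chi-square sum, whose second moment is known.
\<close>

lemma W2_chi_matched:
  assumes l: "inj_on l {..<q}" and \<Lambda>: "\<Lambda> = l ` {..<q}"
    and \<sigma>: "inj_on \<sigma> \<Lambda>" "\<sigma> ` \<Lambda> \<subseteq> {..<n}"
    and D: "sqrt ((\<Sum>x\<in>\<Lambda>. (\<mu> (\<sigma> x) - x)\<^sup>2) + (\<Sum>i\<in>{..<n} - \<sigma> ` \<Lambda>. (\<mu> i)\<^sup>2)) \<le> r"
  shows "W2 (distr (gauss_pow n) borel (centred_chi n \<mu>)) (distr (gauss_pow q) borel (centred_chi q l)) \<le> ennreal (2 * r)"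
proof -
  let ?g = "\<lambda>w. centred_chi q l (\<lambda>m\<in>{..<q}. w (\<sigma> (l m)))"
  let ?D = "(\<Sum>x\<in>\<Lambda>. (\<mu> (\<sigma> x) - x)\<^sup>2) + (\<Sum>i\<in>{..<n} - \<sigma> ` \<Lambda>. (\<mu> i)\<^sup>2)"
  define \<nu> where "\<nu> k = (if k \<in> \<sigma> ` \<Lambda> then the_inv_into \<Lambda> \<sigma> k else 0)" for k
  have \<nu>: "\<nu> (\<sigma> x) = x" if "x \<in> \<Lambda>" for x
    using that \<sigma>(1) by (simp add: \<nu>_def the_inv_into_f_f)
  have "?g w = (\<Sum>x\<in>\<Lambda>. x * ((w (\<sigma> x))\<^sup>2 - 1))" for w
    unfolding \<Lambda> centred_chi_def using l by (simp add: sum.reindex)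
  also have "\<dots> w = (\<Sum>k\<in>\<sigma> ` \<Lambda>. \<nu> k * ((w k)\<^sup>2 - 1))" for w
    using \<sigma>(1) \<nu> by (simp add: sum.reindex)
  also have "\<dots> w = centred_chi n \<nu> w" for w
    unfolding centred_chi_def using \<sigma>(2) by (intro sum.mono_neutral_left) (auto simp: \<nu>_def)
  finally have g_eq: "?g w = centred_chi n \<nu> w" for w .
  have diff: "centred_chi n \<mu> w - ?g w = centred_chi n (\<lambda>k. \<mu> k - \<nu> k) w" for w
    unfolding g_eq by (simp add: centred_chi_def left_diff_distrib sum_subtractf)
  have "(\<Sum>k<n. (\<mu> k - \<nu> k)\<^sup>2) = (\<Sum>k\<in>\<sigma> ` \<Lambda>. (\<mu> k - \<nu> k)\<^sup>2) + (\<Sum>k\<in>{..<n} - \<sigma> ` \<Lambda>. (\<mu> k - \<nu> k)\<^sup>2)"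
    using sum.subset_diff[OF \<sigma>(2)] by (simp add: add.commute)
  also have "\<dots> = ?D"
    using \<sigma>(1) \<nu> by (simp add: sum.reindex) (simp add: \<nu>_def)
  finally have sum: "(\<Sum>k<n. (\<mu> k - \<nu> k)\<^sup>2) = ?D" .
  have D0: "0 \<le> ?D" by (intro add_nonneg_nonneg sum_nonneg) auto
  then have r: "0 \<le> r" using D real_sqrt_ge_zero[OF D0] by linarith
  have "?D \<le> r\<^sup>2" using D by (rule sqrt_le_D)
  then have "2 * ?D \<le> 2 * r\<^sup>2" by (rule mult_left_mono) simp
  also have "\<dots> \<le> (2 * r)\<^sup>2" by (simp add: power_mult_distrib)
  finally have "2 * ?D \<le> (2 * r)\<^sup>2" .
  then have cost: "(\<integral>\<^sup>+ w. ennreal ((centred_chi n \<mu> w - ?g w)\<^sup>2) \<partial>gauss_pow n) \<le> ennreal ((2 * r)\<^sup>2)"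
    unfolding diff chi_second_moment sum by (rule ennreal_leI)
  have t: "inj_on (\<lambda>m. \<sigma> (l m)) {..<q}" "(\<lambda>m. \<sigma> (l m)) ` {..<q} \<subseteq> {..<n}"
    using comp_inj_on[OF l \<sigma>(1)[unfolded \<Lambda>]] \<sigma>(2) unfolding \<Lambda> image_image by (simp_all add: o_def)
  note g = distr_chi_reindex[OF t, of l]
  show ?thesis
    using W2_distr_le[OF prob_space_gauss_pow measurable_chi g(1) cost] r unfolding g(2) by simp
qed

lemma W2_chi:
  assumes l: "inj_on l {..<q}" and \<Lambda>: "\<Lambda> = l ` {..<q}" and one: "(\<Sum>m<q. (l m)\<^sup>2) = 1"
    and sep: "matching_constant \<Lambda> K" and \<mu>: "(\<Sum>k<n. (\<mu> k)\<^sup>2) = 1"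
  shows "W2 (distr (gauss_pow n) borel (centred_chi n \<mu>)) (distr (gauss_pow q) borel (centred_chi q l))
    \<le> ennreal (2 * K * rate \<Lambda> (gap n \<mu> \<Lambda>))"
proof -
  let ?R = "rate \<Lambda> (gap n \<mu> \<Lambda>)"
  from sep \<mu> have "4 \<le> K * ?R \<or> (\<exists>\<sigma>. inj_on \<sigma> \<Lambda> \<and> \<sigma> ` \<Lambda> \<subseteq> {..<n} \<and>
      sqrt ((\<Sum>x\<in>\<Lambda>. (\<mu> (\<sigma> x) - x)\<^sup>2) + (\<Sum>i\<in>{..<n} - \<sigma> ` \<Lambda>. (\<mu> i)\<^sup>2)) \<le> K * ?R)"
    unfolding matching_constant_def by blast
  then show ?thesis
  proof
    assume "4 \<le> K * ?R"
    then have "ennreal 2 \<le> ennreal (2 * K * ?R)" by (intro ennreal_leI) (simp add: mult.assoc)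
    with W2_chi_trivial[OF \<mu> one] show ?thesis by (rule order_trans)
  next
    assume "\<exists>\<sigma>. inj_on \<sigma> \<Lambda> \<and> \<sigma> ` \<Lambda> \<subseteq> {..<n} \<and>
      sqrt ((\<Sum>x\<in>\<Lambda>. (\<mu> (\<sigma> x) - x)\<^sup>2) + (\<Sum>i\<in>{..<n} - \<sigma> ` \<Lambda>. (\<mu> i)\<^sup>2)) \<le> K * ?R"
    then obtain \<sigma> where "inj_on \<sigma> \<Lambda>" "\<sigma> ` \<Lambda> \<subseteq> {..<n}"
      "sqrt ((\<Sum>x\<in>\<Lambda>. (\<mu> (\<sigma> x) - x)\<^sup>2) + (\<Sum>i\<in>{..<n} - \<sigma> ` \<Lambda>. (\<mu> i)\<^sup>2)) \<le> K * ?R" by blast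
    from W2_chi_matched[OF l \<Lambda> this] show ?thesis by (simp add: mult.assoc)
  qed
qed

lemma law_chi_square_comb:
  assumes iid: "iid_std_normal M Z" and q: "q > 0"
  shows "distr M borel (chi_square_comb q l Z) = distr (gauss_pow q) borel (centred_chi q l)"
proof -
  note Z = iid_distr_gauss_pow[OF iid q]
  have "chi_square_comb q l Z = centred_chi q l \<circ> (\<lambda>\<omega>. \<lambda>i\<in>{..<q}. Z i \<omega>)"
    by (rule ext) (simp add: chi_square_comb_def centred_chi_def)
  then show ?thesis using distr_distr[OF measurable_chi Z(1), of l] by (simp add: Z(2))
qed

lemma law_centred_quad_form:
  assumes iid: "iid_std_normal M Z" and n: "n > 0" and A: "A \<in> carrier_mat n n"
    and U: "U \<in> gauss_orth n" and D: "U * A * transpose_mat U = mat_diag n \<mu>"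
  shows "distr M borel (\<lambda>\<omega>. quad_form A Z \<omega> - prob_space.expectation M (quad_form A Z)) =
    distr (gauss_pow n) borel (centred_chi n \<mu>)"
proof -
  define V where "V = apply_mat n U \<circ> (\<lambda>\<omega>. \<lambda>i\<in>{..<n}. Z i \<omega>)"
  note Z = iid_distr_gauss_pow[OF iid n]
  note [measurable] = Z(1)
  have V [measurable]: "V \<in> measurable M (gauss_pow n)" unfolding V_def o_def by measurable
  have dV: "distr M (gauss_pow n) V = gauss_pow n"
    unfolding V_def
    using distr_distr[OF measurable_apply_mat Z(1), of U] by (simp add: Z(2) gauss_orthD(4)[OF U])
  have Q: "quad_form A Z \<omega> = (\<Sum>k<n. \<mu> k * (V \<omega> k)\<^sup>2)" for \<omega>
  proof -
    have "V \<omega> = apply_mat n U (\<lambda>i. Z i \<omega>)" unfolding V_def o_def by (rule apply_mat_cong) simp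
    then show ?thesis
      using diagonalised(1)[OF U A D, of "\<lambda>i. Z i \<omega>"] A by (simp add: quad_form_def)
  qed
  have [measurable]: "(\<lambda>w. \<Sum>k<n. \<mu> k * (w k)\<^sup>2) \<in> borel_measurable (gauss_pow n)"
    by (intro borel_measurable_sum borel_measurable_times borel_measurable_power
        borel_measurable_const measurable_gauss_pow_component) simp
  have "prob_space.expectation M (quad_form A Z) = (\<integral>\<omega>. (\<Sum>k<n. \<mu> k * (V \<omega> k)\<^sup>2) \<partial>M)"
    by (rule Bochner_Integration.integral_cong) (simp_all add: Q)
  also have "\<dots> = (\<integral>w. (\<Sum>k<n. \<mu> k * (w k)\<^sup>2) \<partial>distr M (gauss_pow n) V)"
    by (rule integral_distr[symmetric]) measurable
  also have "\<dots> = (\<Sum>k<n. \<mu> k)"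
    unfolding dV by (simp add: gauss_pow_component_square)
  finally have "quad_form A Z \<omega> - prob_space.expectation M (quad_form A Z) = centred_chi n \<mu> (V \<omega>)" for \<omega>
    by (simp add: Q centred_chi_def right_diff_distrib sum_subtractf)
  then have "distr M borel (\<lambda>\<omega>. quad_form A Z \<omega> - prob_space.expectation M (quad_form A Z)) =
      distr M borel (centred_chi n \<mu> \<circ> V)" by (simp add: o_def)
  also have "\<dots> = distr (distr M (gauss_pow n) V) borel (centred_chi n \<mu>)"
    by (rule distr_distr[symmetric]) measurable
  finally show ?thesis unfolding dV .
qed

lemma chi_mgf_on_chi:
  assumes l: "inj_on l {..<q}" "\<And>m. m < q \<Longrightarrow> l m \<noteq> 0" and one: "(\<Sum>m<q. (l m)\<^sup>2) = 1"
  shows "chi_mgf_on (distr (gauss_pow q) borel (centred_chi q l)) (l ` {..<q})"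
  unfolding chi_mgf_on_def
proof (intro conjI allI impI)
  show 1: "(\<Sum>x\<in>l ` {..<q}. x\<^sup>2) = 1" using l(1) one by (simp add: sum.reindex)
  fix s :: real assume s: "\<bar>s\<bar> < 1 / 2"
  have b: "2 * (s * l k) < 1" if "k < q" for k
    by (rule unit_sum_squares_bound[OF _ 1 _ s]) (use that in auto)
  have "(\<integral>\<^sup>+ y. ennreal (exp (s * y)) \<partial>distr (gauss_pow q) borel (centred_chi q l)) =
      (\<integral>\<^sup>+ w. ennreal (exp (s * centred_chi q l w)) \<partial>gauss_pow q)"
    by (rule nn_integral_distr) measurable
  also have "\<dots> = ennreal (\<Prod>k<q. exp (- (s * l k)) / sqrt (1 - 2 * (s * l k)))"
    by (rule chi_mgf) (rule b)
  also have "(\<Prod>k<q. exp (- (s * l k)) / sqrt (1 - 2 * (s * l k))) =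
      (\<Prod>x\<in>l ` {..<q}. exp (- (s * x)) / sqrt (1 - 2 * (s * x)))"
    by (simp only: prod.reindex[OF l(1)] o_def)
  finally show "(\<integral>\<^sup>+ y. ennreal (exp (s * y)) \<partial>distr (gauss_pow q) borel (centred_chi q l)) =
      ennreal (\<Prod>x\<in>l ` {..<q}. exp (- (s * x)) / sqrt (1 - 2 * (s * x)))" .
qed (use l(2) in auto)

text \<open>
  The constant may depend on the law only, while \<open>matching_constant_exists\<close> supplies one for a set of
  coefficients. These fit together because the law determines the set.
\<close>

lemma law_constant:
  obtains C :: "real measure \<Rightarrow> real"
  where "\<And>L. 0 < C L" "\<And>L \<Lambda>. chi_mgf_on L \<Lambda> \<Longrightarrow> matching_constant \<Lambda> (C L)"
proof -
  have "\<exists>K>0. \<forall>\<Lambda>. chi_mgf_on L \<Lambda> \<longrightarrow> matching_constant \<Lambda> K" for L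
  proof (cases "\<exists>\<Lambda>. chi_mgf_on L \<Lambda>")
    case True
    then obtain \<Lambda> where \<Lambda>: "chi_mgf_on L \<Lambda>" ..
    then have "finite \<Lambda>" "0 \<notin> \<Lambda>" "(\<Sum>x\<in>\<Lambda>. x\<^sup>2) = 1" by (auto simp: chi_mgf_on_def)
    then obtain K where "K > 0" "matching_constant \<Lambda> K" by (rule matching_constant_exists)
    moreover have "\<Lambda>' = \<Lambda>" if "chi_mgf_on L \<Lambda>'" for \<Lambda>' using chi_mgf_on_unique[OF that \<Lambda>] .
    ultimately show ?thesis by blast
  qed (auto intro: exI[of _ 1])
  then have "\<exists>C. \<forall>L. 0 < C L \<and> (\<forall>\<Lambda>. chi_mgf_on L \<Lambda> \<longrightarrow> matching_constant \<Lambda> (C L))" by (intro choice) blast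
  then show thesis using that by blast
qed

lemma root_poly_image:
  assumes "inj_on l {..<q}"
  shows "coeff ((root_poly (l ` {..<q}))\<^sup>2) r = Theta q l r"
  unfolding root_poly_def Theta_def by (simp only: prod.reindex[OF assms] o_def)

lemma normalized_coeff_props:
  assumes "1 \<le> q" "inj_on l {..<q}" "\<forall>m<q. l m \<noteq> 0"
  shows "inj_on (normalized_coeff q l) {..<q}" "\<And>m. m < q \<Longrightarrow> normalized_coeff q l m \<noteq> 0"
    "(\<Sum>m<q. (normalized_coeff q l m)\<^sup>2) = 1"
proof -
  let ?S = "\<Sum>k<q. (l k)\<^sup>2"
  have "0 < (l 0)\<^sup>2" using assms by simp
  also have "\<dots> \<le> ?S" using assms(1) by (intro member_le_sum) auto
  finally have S: "?S > 0" .
  show "inj_on (normalized_coeff q l) {..<q}" "\<And>m. m < q \<Longrightarrow> normalized_coeff q l m \<noteq> 0"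
    using S assms by (auto simp: normalized_coeff_def inj_on_def)
  show "(\<Sum>m<q. (normalized_coeff q l m)\<^sup>2) = 1"
    using S by (simp add: normalized_coeff_def power_divide sum_divide_distrib[symmetric])
qed

lemma normalized_mat_props:
  assumes A: "A \<in> carrier_mat n n" "transpose_mat A = A" and s: "sum_squares A \<noteq> 0"
  shows "normalized_mat A \<in> carrier_mat n n" "transpose_mat (normalized_mat A) = normalized_mat A"
    "sum_squares (normalized_mat A) = 1" "n > 0"
proof -
  show "normalized_mat A \<in> carrier_mat n n" using A by (simp add: normalized_mat_def)
  show "transpose_mat (normalized_mat A) = normalized_mat A"
    using A(1) symmetric_entry[OF A] by (intro eq_matI) (auto simp: normalized_mat_def)
  have "sum_squares A \<ge> 0" unfolding sum_squares_def by (intro sum_nonneg) auto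
  then have pos: "sum_squares A > 0" using s by simp
  have "sum_squares (c \<cdot>\<^sub>m A) = c\<^sup>2 * sum_squares A" for c
    by (simp add: sum_squares_def sum_distrib_left power_mult_distrib)
  then show "sum_squares (normalized_mat A) = 1"
    using pos by (simp add: normalized_mat_def power_divide)
  show "n > 0" using s A by (cases n) (auto simp: sum_squares_def)
qed

theorem mainTheorem9:
  shows "\<exists>C :: real measure \<Rightarrow> real. (\<forall>L. 0 < C L) \<and>
    (\<forall>(M :: 'a measure) (Z :: nat \<Rightarrow> 'a \<Rightarrow> real) (q :: nat) (l :: nat \<Rightarrow> real)
       (A :: nat \<Rightarrow> real mat) (b :: nat \<Rightarrow> nat \<Rightarrow> nat \<Rightarrow> real).
      iid_std_normal M Z \<longrightarrow>
      1 \<le> q \<longrightarrow>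
      inj_on l {..<q} \<longrightarrow>
      (\<forall>m<q. l m \<noteq> 0) \<longrightarrow>
      (\<forall>n. A n \<in> carrier_mat n n \<and> transpose_mat (A n) = A n) \<longrightarrow>
      (\<forall>k<q. \<forall>m<q. (\<lambda>n. \<Sum>i<n. b n m i * b n k i) \<longlonglongrightarrow> (if k = m then 1 else 0)) \<longrightarrow>
      (\<exists>\<beta>>0. \<forall>n. \<forall>m<q. \<forall>i<n. sqrt (real n) * \<bar>b n m i\<bar> \<le> \<beta>) \<longrightarrow>
      (\<forall>m<q. (\<lambda>n. \<Sum>i<n. \<Sum>j<n. A n $$ (i, j) * b n m i * b n m j) \<longlonglongrightarrow> l m) \<longrightarrow>
      (\<lambda>n. sum_squares (A n)) \<longlonglongrightarrow> (\<Sum>m<q. (l m)\<^sup>2) \<longrightarrow>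
      (\<forall>n. sum_squares (A n) \<noteq> 0 \<longrightarrow>
        (let At = normalized_mat (A n);
             lt = normalized_coeff q l;
             Qn = quad_form At Z;
             law_Qn = distr M borel (\<lambda>\<omega>. Qn \<omega> - prob_space.expectation M Qn);
             law_Qinf = distr M borel (chi_square_comb q lt Z);
             gap = (\<lambda>r. mat_trace (At ^\<^sub>m r) - (\<Sum>m<q. lt m ^ r))
         in W2 law_Qn law_Qinf \<le> ennreal (C law_Qinf *
              (sqrt (\<Sum>r = 2..2 * q + 2. Theta q lt r * gap r)
               + (\<Sum>r = 2..q + 1. 2 ^ (r - 1) * fact (r - 1) * \<bar>gap r\<bar>))))))"
proof -
  obtain K :: "real measure \<Rightarrow> real" where K: "\<And>L. 0 < K L"
    "\<And>L \<Lambda>. chi_mgf_on L \<Lambda> \<Longrightarrow> matching_constant \<Lambda> (K L)"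
    using law_constant by blast
  show ?thesis
  proof (rule exI[of _ "\<lambda>L. 2 * K L"], intro conjI allI impI)
    show "0 < 2 * K L" for L using K(1) by simp
  next
    fix M :: "'a measure" and Z :: "nat \<Rightarrow> 'a \<Rightarrow> real" and q n :: nat and l :: "nat \<Rightarrow> real"
      and A :: "nat \<Rightarrow> real mat" and b :: "nat \<Rightarrow> nat \<Rightarrow> nat \<Rightarrow> real"
    assume iid: "iid_std_normal M Z" and q: "1 \<le> q" and l: "inj_on l {..<q}" "\<forall>m<q. l m \<noteq> 0"
      and A: "\<forall>n. A n \<in> carrier_mat n n \<and> transpose_mat (A n) = A n"
      and s: "sum_squares (A n) \<noteq> 0"
    define lt where "lt = normalized_coeff q l"
    define At where "At = normalized_mat (A n)"
    define \<Lambda> where "\<Lambda> = lt ` {..<q}"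
    note lt = normalized_coeff_props[OF q l, folded lt_def]
    note At = normalized_mat_props[OF A[rule_format, THEN conjunct1] A[rule_format, THEN conjunct2] s, folded At_def]
    obtain U \<mu> where U: "U \<in> gauss_orth n" "U * At * transpose_mat U = mat_diag n \<mu>"
      by (rule spectral_gauss_orth[OF At(1,2)])
    have \<mu>: "(\<Sum>k<n. (\<mu> k)\<^sup>2) = 1"
      using sum_squares_eq_trace[OF At(1,2)] At(3) diagonalised(2)[OF U(1) At(1) U(2), of 2] by simp
    let ?L = "distr M borel (chi_square_comb q lt Z)"
    have L: "?L = distr (gauss_pow q) borel (centred_chi q lt)"
      using law_chi_square_comb[OF iid] q by simp
    have sep: "matching_constant \<Lambda> (K ?L)"
      unfolding L \<Lambda>_def by (intro K(2) chi_mgf_on_chi lt)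
    have gap: "mat_trace (At ^\<^sub>m r) - (\<Sum>m<q. lt m ^ r) = gap n \<mu> \<Lambda> r" for r
      unfolding gap_def \<Lambda>_def by (simp add: diagonalised(2)[OF U(1) At(1) U(2)] sum.reindex[OF lt(1)])
    have card: "card \<Lambda> = q" unfolding \<Lambda>_def using lt(1) by (simp add: card_image)
    have rate: "rate \<Lambda> (gap n \<mu> \<Lambda>) = sqrt (\<Sum>r = 2..2 * q + 2. Theta q lt r * gap n \<mu> \<Lambda> r)
        + (\<Sum>r = 2..q + 1. 2 ^ (r - 1) * fact (r - 1) * \<bar>gap n \<mu> \<Lambda> r\<bar>)"
      unfolding rate_def defect_def card by (simp add: \<Lambda>_def root_poly_image[OF lt(1)])
    have "W2 (distr M borel (\<lambda>\<omega>. quad_form At Z \<omega> - prob_space.expectation M (quad_form At Z))) ?L \<le>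
        ennreal (2 * K ?L * rate \<Lambda> (gap n \<mu> \<Lambda>))"
      unfolding law_centred_quad_form[OF iid At(4,1) U] 
      using W2_chi[OF lt(1) \<Lambda>_def lt(3) sep \<mu>] unfolding L .
    then show "let At = normalized_mat (A n);
             lt = normalized_coeff q l;
             Qn = quad_form At Z;
             law_Qn = distr M borel (\<lambda>\<omega>. Qn \<omega> - prob_space.expectation M Qn);
             law_Qinf = distr M borel (chi_square_comb q lt Z);
             gap = (\<lambda>r. mat_trace (At ^\<^sub>m r) - (\<Sum>m<q. lt m ^ r))
         in W2 law_Qn law_Qinf \<le> ennreal (2 * K law_Qinf *
              (sqrt (\<Sum>r = 2..2 * q + 2. Theta q lt r * gap r)
               + (\<Sum>r = 2..q + 1. 2 ^ (r - 1) * fact (r - 1) * \<bar>gap r\<bar>)))"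
      unfolding Let_def lt_def[symmetric] At_def[symmetric] gap rate .
  qed
qed

end
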